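(* Let $\alpha\in\mathbb{R}$ with $\alpha\ge1$, let $\ell\in\{0,1,\ldots,\lfloor\alpha-\tfrac12\rfloor\}$, and let $\varphi$ be the pseudo-spline of order $(\alpha,\ell)$. Let $$p(x):=\sum_{k=0}^{\ell}\binom{\alpha+\ell}{k}x^k(1-x)^{\ell-k},\qquad \kappa:=\log_2 p(\tfrac34).$$ Then there is a constant $c>0$ such that $$|\widehat{\varphi}(\gamma)|\le c\,(1+|\gamma|)^{-2\alpha+\kappa}\qquad\text{for all }\gamma\in\mathbb{R}.$$ Moreover, with $s:=2\alpha-\kappa-1$, one has $\varphi\in C^{s-\varepsilon}$ for every $\varepsilon>0$ (with $s-\varepsilon\ge0$).
   Context: The Fourier transform is $\widehat{f}(\gamma)=\int_{\mathbb{R}}f(t)e^{-2\pi i t\gamma}\,dt$ (extended to $L^2(\mathbb{R})$). The (fractional) pseudo-spline $\varphi$ of order $(\alpha,\ell)$ is the function in $L^2(\mathbb{R})$ whose Fourier transform is $\widehat{\varphi}(\gamma)=\prod_{m=1}^\infty H_0(2^{-m}\gamma)$ (so $\widehat{\varphi}(0)=1$), where $$H_0(\gamma):=H_0^{(\alpha,\ell)}(\gamma):=(\cos^2\pi\gamma)^\alpha\sum_{k=0}^{\ell}\binom{\alpha+\ell}{k}(\sin^2\pi\gamma)^k(\cos^2\pi\gamma)^{\ell-k}.$$ For real $w$ and $k\in\mathbb{N}_0$, $\binom{w}{k}:=\frac{\Gamma(w+1)}{\Gamma(k+1)\Gamma(w-k+1)}$; $0^0:=1$ for integer powers. For $r\ge0$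 with integer part $n=\lfloor r\rfloor$, $C^r$ denotes the Hölder space of functions on $\mathbb{R}$ that are $n$ times continuously differentiable and, if $r>n$, whose $n$-th derivative is Hölder continuous with exponent $r-n$; membership of $\varphi$ is understood after modification on a null set. *)

theory Defs
  imports "HOL-Analysis.Analysis"
begin

section \<open>Fourier transform on the real line\<close>

definition fourier :: "(real \<Rightarrow> complex) \<Rightarrow> real \<Rightarrow> complex" where
  "fourier f \<gamma> =
     (LINT t|lborel. f t * exp (- 2 * of_real pi * \<i> * of_real t * of_real \<gamma>))"

text \<open>Square-integrable functions. Elements of the quotient space are handled through their
  Borel representatives.\<close>

definition L2 :: "(real \<Rightarrow> complex) set" where
  "L2 = {f \<in> borel_measurable lborel. integrable lborel (\<lambda>x. (cmod (f x))\<^sup>2)}"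

text \<open>The extension of \<open>fourier\<close> from the dense subspace of integrable functions in \<open>L2\<close> to all
  of \<open>L2\<close> by continuity. It is a relation, since \<open>g\<close> is determined only up to a null set. The
  squared distances are \<open>ennreal\<close>-valued, so a divergent one does not count as zero.\<close>

definition has_L2_fourier :: "(real \<Rightarrow> complex) \<Rightarrow> (real \<Rightarrow> complex) \<Rightarrow> bool" where
  "has_L2_fourier f g \<longleftrightarrow> f \<in> L2 \<and> g \<in> L2 \<and>
     (\<exists>F :: nat \<Rightarrow> real \<Rightarrow> complex.
        (\<forall>n. F n \<in> L2 \<and> integrable lborel (F n)) \<and>
        (\<lambda>n. \<integral>\<^sup>+ x. ennreal ((cmod (F n x - f x))\<^sup>2) \<partial>lborel) \<longlonglongrightarrow> 0 \<and>
        (\<lambda>n. \<integral>\<^sup>+ \<gamma>. ennreal ((cmod (fourier (F n) \<gamma> - g \<gamma>))\<^sup>2) \<partial>lborel) \<longlonglongrightarrow> 0)"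

section \<open>Fractional pseudo-splines\<close>

definition gamma_binomial :: "real \<Rightarrow> nat \<Rightarrow> real" where
  "gamma_binomial w k = Gamma (w + 1) / (Gamma (real k + 1) * Gamma (w - real k + 1))"

definition ps_poly :: "real \<Rightarrow> nat \<Rightarrow> real \<Rightarrow> real" where
  "ps_poly \<alpha> l x = (\<Sum>k=0..l. gamma_binomial (\<alpha> + real l) k * x ^ k * (1 - x) ^ (l - k))"

definition ps_mask :: "real \<Rightarrow> nat \<Rightarrow> real \<Rightarrow> real" where
  "ps_mask \<alpha> l \<gamma> = ((cos (pi * \<gamma>))\<^sup>2) powr \<alpha> *
     (\<Sum>k=0..l. gamma_binomial (\<alpha> + real l) k *
        ((sin (pi * \<gamma>))\<^sup>2) ^ k * ((cos (pi * \<gamma>))\<^sup>2) ^ (l - k))"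

text \<open>The factors are indexed from 0, hence the shift in the exponent. The value is the
  canonical pointwise representative of the Fourier transform of the pseudo-spline.\<close>

definition ps_hat :: "real \<Rightarrow> nat \<Rightarrow> real \<Rightarrow> complex" where
  "ps_hat \<alpha> l \<gamma> = complex_of_real (prodinf (\<lambda>m. ps_mask \<alpha> l (\<gamma> / 2 ^ Suc m)))"

definition is_pseudo_spline :: "real \<Rightarrow> nat \<Rightarrow> (real \<Rightarrow> complex) \<Rightarrow> bool" where
  "is_pseudo_spline \<alpha> l \<phi> \<longleftrightarrow> has_L2_fourier \<phi> (ps_hat \<alpha> l)"

definition ps_kappa :: "real \<Rightarrow> nat \<Rightarrow> real" where
  "ps_kappa \<alpha> l = log 2 (ps_poly \<alpha> l (3/4))"

section \<open>Hoelder spaces\<close>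

text \<open>For \<open>r \<ge> 0\<close>; \<open>D i\<close> is the \<open>i\<close>-th derivative of \<open>f\<close>. The Hoelder condition is global on the
  real line, and no boundedness of the derivatives is required.\<close>

definition holder_space :: "real \<Rightarrow> (real \<Rightarrow> complex) set" where
  "holder_space r = {f. \<exists>D :: nat \<Rightarrow> real \<Rightarrow> complex. let n = nat \<lfloor>r\<rfloor> in
     D 0 = f \<and>
     (\<forall>i<n. \<forall>x. (D i has_vector_derivative D (Suc i) x) (at x)) \<and>
     continuous_on UNIV (D n) \<and>
     (real n < r \<longrightarrow>
        (\<exists>C. \<forall>x y. cmod (D n x - D n y) \<le> C * \<bar>x - y\<bar> powr (r - real n)))}"

end

theory Submission
  imports Defs "HOL-Probability.Levy"
begin

text \<open>The polynomial \<open>p\<close> is the Taylor polynomial of \<open>(1 - y) powr (- \<alpha>)\<close> of degree \<open>l\<close>, so it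
  satisfies a first order differential equation with a single monomial as defect. This
  yields \<open>p t * p (4 * t * (1 - t)) \<le> (p (3/4))\<^sup>2\<close> for \<open>3/4 \<le> t \<le> 1\<close>. The map \<open>y \<mapsto> 4 * y * (1 - y)\<close>
  is the doubling of the angle for \<open>y = sin\<^sup>2\<close>, so the factors \<open>p\<close> in the product for the Fourier
  transform contribute at most a constant times \<open>p (3/4) ^ n\<close> over \<open>n\<close> dyadic scales, while the cosines
  telescope to \<open>sin (\<pi> \<gamma>) / (2 ^ n * sin (\<pi> \<gamma> / 2 ^ n))\<close>. Regularity follows from the decay by
  differentiating the inverse Fourier integral. That this integral represents \<open>\<phi>\<close> is tested
  against modulated Gaussians: the difference, multiplied by a Gaussian, is integrable with
  vanishing Fourier transform, hence zero by Levy's uniqueness theorem.\<close>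

section \<open>The truncated binomial series\<close>

text \<open>For \<open>\<bar>y\<bar> < 1\<close>, \<open>nb_poly a l y\<close> is a partial sum of the series of \<open>(1 - y) powr (- a)\<close>.\<close>

definition nb_coeff :: "real \<Rightarrow> nat \<Rightarrow> real" where
  "nb_coeff a k = pochhammer a k / fact k"

definition nb_poly :: "real \<Rightarrow> nat \<Rightarrow> real \<Rightarrow> real" where
  "nb_poly a l y = (\<Sum>k\<le>l. nb_coeff a k * y ^ k)"

definition nb_deriv :: "real \<Rightarrow> nat \<Rightarrow> real \<Rightarrow> real" where
  "nb_deriv a l y = (\<Sum>k\<le>l. nb_coeff a k * (real k * y ^ (k - 1)))"

lemma gamma_binomial_eq_gbinomial:
  assumes "w - real k + 1 > 0"
  shows "gamma_binomial w k = w gchoose k"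
proof -
  have "w + 1 > 0" using assms by linarith
  then have "w + 1 \<notin> \<int>\<^sub>\<le>\<^sub>0" by (auto elim!: nonpos_Ints_cases)
  then show ?thesis
    using Gamma_fact[of k, where 'a = real]
    by (simp add: gamma_binomial_def gbinomial_Gamma add.commute)
qed

text \<open>In the partial-sum identity \<open>gbinomial_partial_sum_poly\<close> the powers of
  \<open>x + (1 - x)\<close> are all 1. Negating the upper index then turns the binomials into
  rising factorials, so the coefficients become nonnegative and independent of
  \<open>l\<close>.\<close>

lemma ps_poly_eq_nb_poly:
  assumes "a > 0"
  shows "ps_poly a l x = nb_poly a l x"
proof -
  have "ps_poly a l x = (\<Sum>k\<le>l. (real l + a gchoose k) * x ^ k * (1 - x) ^ (l - k))"
    using assms unfolding ps_poly_def
    by (intro sum.cong) (auto simp: gamma_binomial_eq_gbinomial add.commute)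
  also have "\<dots> = (\<Sum>k\<le>l. (- a gchoose k) * (- x) ^ k * (x + (1 - x)) ^ (l - k))"
    by (rule gbinomial_partial_sum_poly)
  also have "\<dots> = nb_poly a l x"
    unfolding nb_poly_def nb_coeff_def
    by (intro sum.cong) (auto simp: gbinomial_pochhammer power_minus[of x])
  finally show ?thesis .
qed

lemma nb_coeff_0 [simp]: "nb_coeff a 0 = 1"
  by (simp add: nb_coeff_def)

lemma nb_coeff_Suc: "nb_coeff a (Suc k) * real (Suc k) = (a + real k) * nb_coeff a k"
  by (simp add: nb_coeff_def pochhammer_rec' field_simps del: of_nat_Suc)

lemma nb_coeff_nonneg: "a \<ge> 0 \<Longrightarrow> nb_coeff a k \<ge> 0"
  by (simp add: nb_coeff_def pochhammer_prod prod_nonneg)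

text \<open>Each ratio \<open>(a + k) / (k + 1)\<close> of consecutive coefficients is at least
  1.\<close>

lemma nb_coeff_ge_1:
  assumes "a \<ge> 1"
  shows "nb_coeff a k \<ge> 1"
proof (induction k)
  case (Suc k)
  have "real (Suc k) * 1 \<le> (a + real k) * nb_coeff a k"
    using assms Suc by (intro mult_mono) auto
  then have "real (Suc k) * 1 \<le> real (Suc k) * nb_coeff a (Suc k)"
    using nb_coeff_Suc[of a k] by (simp add: mult.commute)
  then show ?case by (subst (asm) mult_le_cancel_left_pos) auto
qed auto

lemma nb_poly_mono:
  assumes "a \<ge> 0" "0 \<le> x" "x \<le> y"
  shows "nb_poly a l x \<le> nb_poly a l y"
  unfolding nb_poly_def
  by (intro sum_mono mult_left_mono power_mono nb_coeff_nonneg assms)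

lemma nb_poly_0 [simp]: "nb_poly a l 0 = 1"
  by (simp add: nb_poly_def power_0_left sum.atMost_shift)

lemma nb_poly_ge_1:
  assumes "a \<ge> 0" "0 \<le> y"
  shows "nb_poly a l y \<ge> 1"
  using nb_poly_mono[of a 0 y l] assms by simp

section \<open>Derivative of the truncated series and its differential equation\<close>

lemma nb_poly_has_deriv: "(nb_poly a l has_real_derivative nb_deriv a l y) (at y)"
  unfolding nb_poly_def[abs_def] nb_deriv_def
  by (auto intro!: derivative_eq_intros sum.cong)

lemma nb_deriv_nonneg: "a \<ge> 0 \<Longrightarrow> y \<ge> 0 \<Longrightarrow> nb_deriv a l y \<ge> 0"
  unfolding nb_deriv_def by (intro sum_nonneg mult_nonneg_nonneg nb_coeff_nonneg) auto

text \<open>The full series solves \<open>(1 - y) * u' = a * u\<close>. By the recursion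
  \<open>nb_coeff_Suc\<close> all lower terms still cancel after truncation, and only the monomial
  at the cut remains.\<close>

lemma nb_deriv_ode:
  "(1 - y) * nb_deriv a l y = a * nb_poly a l y - (a + real l) * nb_coeff a l * y ^ l"
proof (induction l)
  case 0
  then show ?case by (simp add: nb_deriv_def nb_poly_def)
next
  case (Suc l)
  let ?C = "nb_coeff a (Suc l) * real (Suc l)"
  have "(1 - y) * nb_deriv a (Suc l) y = (1 - y) * nb_deriv a l y + (1 - y) * ?C * y ^ l"
    by (simp add: nb_deriv_def algebra_simps)
  also have "\<dots> = a * nb_poly a l y - ?C * y ^ l + (1 - y) * ?C * y ^ l"
    using Suc by (simp only: nb_coeff_Suc)
  also have "\<dots> = a * nb_poly a (Suc l) y - (a + real (Suc l)) * nb_coeff a (Suc l) * y ^ Suc l"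
    by (simp add: nb_poly_def algebra_simps)
  finally show ?case .
qed

section \<open>Bounds on the logarithmic derivative and the doubling inequality\<close>

lemma nb_deriv_le:
  assumes "a \<ge> 0" "y \<ge> 0"
  shows "y * nb_deriv a l y \<le> real l * nb_poly a l y"
  unfolding nb_deriv_def nb_poly_def sum_distrib_left
proof (intro sum_mono)
  fix k assume k: "k \<in> {..l}"
  have "y * (nb_coeff a k * (real k * y ^ (k - 1))) = real k * (nb_coeff a k * y ^ k)"
    by (cases k) auto
  also have "\<dots> \<le> real l * (nb_coeff a k * y ^ k)"
    using k assms by (intro mult_right_mono mult_nonneg_nonneg nb_coeff_nonneg) auto
  finally show "y * (nb_coeff a k * (real k * y ^ (k - 1))) \<le> real l * (nb_coeff a k * y ^ k)" .
qed

lemma nb_deriv_ge_top: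
  assumes "a \<ge> 0" "y \<ge> 0"
  shows "real l * (nb_coeff a l * y ^ l) \<le> y * nb_deriv a l y"
proof -
  have "nb_coeff a l * (real l * y ^ (l - 1)) \<le> nb_deriv a l y"
    unfolding nb_deriv_def using assms
    by (intro member_le_sum mult_nonneg_nonneg nb_coeff_nonneg) auto
  then have "y * (nb_coeff a l * (real l * y ^ (l - 1))) \<le> y * nb_deriv a l y"
    using assms by (intro mult_left_mono) auto
  then show ?thesis by (cases l) (auto simp: algebra_simps)
qed

text \<open>The top monomial is eliminated: \<open>nb_deriv_ge_top\<close> bounds it by the
  derivative, and inserting this bound in \<open>nb_deriv_ode\<close> controls the remaining terms
  of the polynomial as well.\<close>

lemma nb_deriv_ge:
  assumes "a \<ge> 0" "y \<ge> 0"
  shows "a * real l * nb_poly a l y \<le> (a * y + real l) * nb_deriv a l y"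
proof -
  have top: "real l * (nb_coeff a l * y ^ l) \<le> y * nb_deriv a l y"
    by (rule nb_deriv_ge_top[OF assms])
  have "a * (nb_poly a l y - nb_coeff a l * y ^ l) \<le> nb_deriv a l y"
    using nb_deriv_ode[of y a l] top by (simp add: algebra_simps)
  from mult_left_mono[OF this, of "real l"] mult_left_mono[OF top assms(1)]
  show ?thesis by (simp add: algebra_simps)
qed

text \<open>The logarithmic derivative of \<open>nb_poly\<close>, multiplied by \<open>1 - y\<close>, decreases, because by
  \<open>nb_deriv_ode\<close> it is \<open>a\<close> minus a multiple of \<open>y ^ l / nb_poly a l y\<close>.\<close>

lemma nb_log_deriv_antimono:
  assumes "a \<ge> 0" "0 \<le> s" "s \<le> t"
  shows "(1 - t) * nb_deriv a l t * nb_poly a l s \<le> (1 - s) * nb_deriv a l s * nb_poly a l t"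
proof -
  \<comment> \<open>Termwise: without the common factor \<open>s ^ k * t ^ k\<close> the claim is
    \<open>s ^ (l - k) \<le> t ^ (l - k)\<close>.\<close>
  have "s ^ l * nb_poly a l t \<le> t ^ l * nb_poly a l s"
    unfolding nb_poly_def sum_distrib_left
  proof (intro sum_mono)
    fix k assume "k \<in> {..l}"
    then have l: "l = k + (l - k)" by simp
    have "nb_coeff a k * (s ^ k * t ^ k) * s ^ (l - k)
        \<le> nb_coeff a k * (s ^ k * t ^ k) * t ^ (l - k)"
      using assms by (intro mult_left_mono power_mono mult_nonneg_nonneg nb_coeff_nonneg) auto
    then show "s ^ l * (nb_coeff a k * t ^ k) \<le> t ^ l * (nb_coeff a k * s ^ k)"
      by (subst (1 2) l) (simp only: power_add mult_ac)
  qed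
  then have "(a + real l) * nb_coeff a l * (s ^ l * nb_poly a l t)
      \<le> (a + real l) * nb_coeff a l * (t ^ l * nb_poly a l s)"
    using assms by (intro mult_left_mono mult_nonneg_nonneg nb_coeff_nonneg) auto
  then show ?thesis
    unfolding nb_deriv_ode by (simp add: algebra_simps)
qed

text \<open>Since \<open>s\<close> has derivative \<open>- 4 * (2 * t - 1)\<close> in
  \<open>t\<close>, this is the sign condition for \<open>nb_poly a l t * nb_poly a l s\<close> to
  decrease. Near 3/4 the monotonicity of the weighted logarithmic derivative suffices; near 1 the
  bounds \<open>nb_deriv_le\<close> and \<open>nb_deriv_ge\<close> do.\<close>

lemma nb_log_deriv_doubling:
  assumes a: "a > 0" "real l \<le> a" and t: "3/4 \<le> t" "t \<le> 1"
  defines "s \<equiv> 4 * t * (1 - t)"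
  shows "nb_deriv a l t * nb_poly a l s \<le> 4 * (2 * t - 1) * (nb_deriv a l s * nb_poly a l t)"
proof -
  have s0: "s \<ge> 0" using t by (simp add: s_def)
  have P0: "nb_deriv a l s * nb_poly a l t \<ge> 0"
    using a t s0 nb_deriv_nonneg[of a s l] nb_poly_ge_1[of a t l] by simp
  \<comment> \<open>Monotonicity gives the factor \<open>(1 - s) / (1 - t)\<close> with
    \<open>1 - s = (2 * t - 1)\<^sup>2\<close>. It stays below the required
    \<open>4 * (2 * t - 1)\<close> as long as \<open>2 * t - 1 \<le> 4 * (1 - t)\<close>, that is,
    up to 5/6.\<close>
  consider "t \<le> 5/6" | "t > 5/6" by linarith
  then show ?thesis
  proof cases
    case 1
    have "s - t = t * (3 - 4 * t)" by (simp add: s_def algebra_simps)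
    also have "\<dots> \<le> 0" using t by (intro mult_nonneg_nonpos) auto
    finally have st: "s \<le> t" by simp
    have "(1 - t) * (nb_deriv a l t * nb_poly a l s)
        \<le> (1 - s) * (nb_deriv a l s * nb_poly a l t)"
      using nb_log_deriv_antimono[of a s t l] a s0 st by (simp add: mult.assoc)
    also have "1 - s = (2 * t - 1) * (2 * t - 1)" by (simp add: s_def algebra_simps)
    also have "\<dots> * (nb_deriv a l s * nb_poly a l t)
        \<le> ((1 - t) * (4 * (2 * t - 1))) * (nb_deriv a l s * nb_poly a l t)"
    proof (intro mult_right_mono[OF _ P0])
      have "(2 * t - 1) * (2 * t - 1) \<le> (4 * (1 - t)) * (2 * t - 1)"
        using 1 t by (intro mult_right_mono) auto
      then show "(2 * t - 1) * (2 * t - 1) \<le> (1 - t) * (4 * (2 * t - 1))"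
        by (simp only: mult_ac)
    qed
    finally have "(1 - t) * (nb_deriv a l t * nb_poly a l s)
        \<le> (1 - t) * (4 * (2 * t - 1) * (nb_deriv a l s * nb_poly a l t))"
      by (simp only: mult_ac)
    then show ?thesis using 1 by (subst (asm) mult_le_cancel_left_pos) auto
  next
    case 2
    \<comment> \<open>The value 5/9 is \<open>s\<close> at \<open>t = 5/6\<close>.\<close>
    have s59: "s \<le> 5/9"
    proof -
      have "5/9 - s = 4 * (t - 1/6) * (t - 5/6)" by (simp add: s_def algebra_simps)
      also have "\<dots> \<ge> 0" using 2 by simp
      finally show ?thesis by simp
    qed
    have "a * t * (nb_deriv a l t * nb_poly a l s)
        = a * (t * nb_deriv a l t) * nb_poly a l s" by simp
    also have "\<dots> \<le> a * (real l * nb_poly a l t) * nb_poly a l s"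
      using a t s0 nb_deriv_le[of a t l] nb_poly_ge_1[of a s l]
      by (intro mult_right_mono mult_left_mono) auto
    also have "\<dots> = nb_poly a l t * (a * real l * nb_poly a l s)" by simp
    also have "\<dots> \<le> nb_poly a l t * ((a * s + real l) * nb_deriv a l s)"
      using a t s0 nb_deriv_ge[of a s l] nb_poly_ge_1[of a t l]
      by (intro mult_left_mono) auto
    also have "\<dots> = (a * s + real l) * (nb_deriv a l s * nb_poly a l t)" by simp
    also have "\<dots> \<le> (a * t * (4 * (2 * t - 1))) * (nb_deriv a l s * nb_poly a l t)"
    proof (intro mult_right_mono[OF _ P0])
      have "a * s + real l \<le> a * (5/9) + a * 1"
        using a s59 by (intro add_mono mult_left_mono) auto
      also have "\<dots> \<le> a * (t * (4 * (2 * t - 1)))"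
      proof -
        \<comment> \<open>At \<open>t = 5/6\<close> the comparison is 14/9 against 20/9, and the
          right side grows with \<open>t\<close>. The summand 1 on the left bounds the ratio of
          \<open>l\<close> to \<open>a\<close>.\<close>
        have "5/9 + 1 \<le> (5/6) * (4 * (2 * (5/6) - 1) :: real)" by simp
        also have "\<dots> \<le> t * (4 * (2 * t - 1))"
          using 2 by (intro mult_mono) auto
        finally have "5/9 + 1 \<le> t * (4 * (2 * t - 1))" .
        then have "a * (5/9 + 1) \<le> a * (t * (4 * (2 * t - 1)))"
          using a by (intro mult_left_mono) auto
        then show ?thesis by (simp only: distrib_left)
      qed
      finally show "a * s + real l \<le> a * t * (4 * (2 * t - 1))" by (simp only: mult_ac)
    qed
    finally have "(a * t) * (nb_deriv a l t * nb_poly a l s)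
        \<le> (a * t) * (4 * (2 * t - 1) * (nb_deriv a l s * nb_poly a l t))"
      by (simp only: mult_ac)
    then show ?thesis using a t by (subst (asm) mult_le_cancel_left_pos) auto
  qed
qed

text \<open>The left side decreases in \<open>t\<close> by \<open>nb_log_deriv_doubling\<close>. At
  3/4, the fixed point of \<open>4 * t * (1 - t)\<close>, it equals the right side.\<close>

lemma nb_poly_doubling:
  assumes a: "a > 0" "real l \<le> a" and t: "3/4 \<le> t" "t \<le> 1"
  shows "nb_poly a l t * nb_poly a l (4 * t * (1 - t)) \<le> (nb_poly a l (3/4))\<^sup>2"
proof -
  let ?F = "\<lambda>t. nb_poly a l t * nb_poly a l (4 * t * (1 - t))"
  have "?F t \<le> ?F (3/4)"
  proof (rule DERIV_nonpos_imp_nonincreasing[OF t(1)])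
    fix x :: real assume x: "3/4 \<le> x" "x \<le> t"
    have "(?F has_real_derivative
        nb_deriv a l x * nb_poly a l (4 * x * (1 - x))
        - 4 * (2 * x - 1) * (nb_deriv a l (4 * x * (1 - x)) * nb_poly a l x)) (at x)"
      by (auto intro!: derivative_eq_intros DERIV_chain2[OF nb_poly_has_deriv]
          nb_poly_has_deriv simp: algebra_simps)
    then show "\<exists>y. (?F has_real_derivative y) (at x) \<and> y \<le> 0"
      using nb_log_deriv_doubling[OF a, of x] x t by (intro exI conjI) auto
  qed
  then show ?thesis by (simp add: power2_eq_square)
qed

text \<open>Factors are split off at the last index. A last value of at most 3/4 costs one factor
  \<open>nb_poly a l (3/4)\<close> by monotonicity. A larger one is taken together with its image,
  the preceding value, and the pair costs the square by \<open>nb_poly_doubling\<close>.\<close>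

lemma nb_orbit_prod_le:
  assumes a: "a > 0" "real l \<le> a"
    and y: "\<And>i. 0 \<le> y i" "\<And>i. y i \<le> 1" "\<And>i. y i = 4 * y (Suc i) * (1 - y (Suc i))"
  shows "(\<Prod>i<n. nb_poly a l (y i)) \<le> nb_poly a l 1 * nb_poly a l (3/4) ^ n"
proof (induction n rule: less_induct)
  case (less n)
  let ?Q = "nb_poly a l (3/4)" and ?M = "nb_poly a l 1"
  have Q: "?Q \<ge> 1" and M: "?M \<ge> 1" using a by (auto intro!: nb_poly_ge_1)
  have pos: "nb_poly a l (y i) \<ge> 1" for i using a y(1,2) by (auto intro!: nb_poly_ge_1)
  have yM: "nb_poly a l (y i) \<le> ?M" for i using a y(1,2) by (auto intro!: nb_poly_mono)
  show ?case
  proof (cases n)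
    case 0
    then show ?thesis using M by simp
  next
    case (Suc m)
    show ?thesis
    proof (cases "y m \<le> 3/4")
      case True
      then have "nb_poly a l (y m) \<le> ?Q" using a y(1,2) by (intro nb_poly_mono) auto
      moreover have "(\<Prod>i<m. nb_poly a l (y i)) \<le> ?M * ?Q ^ m" using less Suc by simp
      ultimately have "(\<Prod>i<m. nb_poly a l (y i)) * nb_poly a l (y m) \<le> (?M * ?Q ^ m) * ?Q"
        using Q M pos[of m] by (intro mult_mono) auto
      then show ?thesis by (simp add: Suc mult_ac)
    next
      case False
      show ?thesis
      proof (cases m)
        case 0
        \<comment> \<open>A large value at index 0 has no partner; the constant
          \<open>nb_poly a l 1\<close> pays for it.\<close>
        have "nb_poly a l (y 0) * 1 \<le> ?M * ?Q"
          using yM[of 0] Q M by (intro mult_mono) auto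
        then show ?thesis by (simp add: Suc 0)
      next
        case (Suc k)
        have "nb_poly a l (y (Suc k)) * nb_poly a l (y k) \<le> ?Q\<^sup>2"
          using nb_poly_doubling[OF a, of "y (Suc k)"] False y(2)[of "Suc k"] y(3)[of k] Suc
          by simp
        moreover have "(\<Prod>i<k. nb_poly a l (y i)) \<le> ?M * ?Q ^ k"
          using less Suc \<open>n = Suc m\<close> by simp
        ultimately have "(\<Prod>i<k. nb_poly a l (y i)) * (nb_poly a l (y (Suc k)) * nb_poly a l (y k))
            \<le> (?M * ?Q ^ k) * ?Q\<^sup>2"
          using Q M pos[of k] pos[of "Suc k"] by (intro mult_mono) auto
        then show ?thesis by (simp add: Suc \<open>n = Suc m\<close> mult_ac power2_eq_square)
      qed
    qed
  qed
qed

section \<open>Decay of the Fourier transform\<close>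

definition nb_mask :: "real \<Rightarrow> nat \<Rightarrow> real \<Rightarrow> real" where
  "nb_mask a l y = (1 - y) powr a * nb_poly a l y"

lemma ps_mask_eq_nb_mask:
  assumes "a > 0"
  shows "ps_mask a l \<gamma> = nb_mask a l ((sin (pi * \<gamma>))\<^sup>2)"
proof -
  have "(cos (pi * \<gamma>))\<^sup>2 = 1 - (sin (pi * \<gamma>))\<^sup>2"
    by (simp add: cos_squared_eq)
  then show ?thesis
    using ps_poly_eq_nb_poly[OF assms, of l "(sin (pi * \<gamma>))\<^sup>2"]
    by (simp add: ps_mask_def nb_mask_def ps_poly_def)
qed

text \<open>By \<open>nb_deriv_ode\<close> the product rule collapses to a single term, whose sign
  and size can be read off.\<close>

lemma nb_mask_has_deriv:
  assumes "y < 1"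
  shows "(nb_mask a l has_real_derivative
    - ((a + real l) * nb_coeff a l * y ^ l * (1 - y) powr (a - 1))) (at y)"
proof -
  have [simp]: "(1 - y) powr a = (1 - y) powr (a - 1) * (1 - y)"
    using assms by (simp add: powr_diff)
  have "- a * ((1 - y) powr (a - 1) * nb_poly a l y)
      + (1 - y) powr (a - 1) * ((1 - y) * nb_deriv a l y)
      = - ((a + real l) * nb_coeff a l * y ^ l * (1 - y) powr (a - 1))"
    unfolding nb_deriv_ode by (simp add: algebra_simps)
  moreover have "(nb_mask a l has_real_derivative - a * ((1 - y) powr (a - 1) * nb_poly a l y)
      + (1 - y) powr (a - 1) * ((1 - y) * nb_deriv a l y)) (at y)"
    unfolding nb_mask_def[abs_def] using assms
    by (auto intro!: derivative_eq_intros nb_poly_has_deriv simp: mult_ac)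
  ultimately show ?thesis by simp
qed

lemma nb_mask_nonneg: "a \<ge> 0 \<Longrightarrow> 0 \<le> y \<Longrightarrow> 0 \<le> nb_mask a l y"
  using nb_poly_ge_1[of a y l] by (simp add: nb_mask_def)

lemma nb_mask_0 [simp]: "nb_mask a l 0 = 1"
  by (simp add: nb_mask_def)

lemma nb_mask_1 [simp]: "nb_mask a l 1 = 0"
  by (simp add: nb_mask_def)

lemma nb_mask_le_1:
  assumes "a \<ge> 0" "0 \<le> y" "y \<le> 1"
  shows "nb_mask a l y \<le> 1"
proof (cases "y = 1")
  case False
  have "nb_mask a l y \<le> nb_mask a l 0"
  proof (rule DERIV_nonpos_imp_nonincreasing[OF assms(2)])
    fix x assume "0 \<le> x" "x \<le> y"
    then show "\<exists>d. (nb_mask a l has_real_derivative d) (at x) \<and> d \<le> 0"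
      using False assms nb_mask_has_deriv[of x a l] nb_coeff_nonneg[of a l]
      by (intro exI conjI) auto
  qed
  then show ?thesis by simp
qed auto

text \<open>Measures how close the mask is to 1 near the origin, for the convergence of the product.
  The derivative of the mask is at least \<open>- ((a + real l) * nb_coeff a l)\<close>, because the
  exponent \<open>a - 1\<close> is nonnegative.\<close>

lemma nb_mask_ge:
  assumes "a \<ge> 1" "0 \<le> y" "y \<le> 1"
  shows "1 - nb_mask a l y \<le> (a + real l) * nb_coeff a l * y"
proof (cases "y = 1")
  case True
  have "1 * 1 \<le> (a + real l) * nb_coeff a l"
    using assms nb_coeff_ge_1[of a l] by (intro mult_mono) auto
  then show ?thesis using True by simp
next
  case False
  let ?K = "(a + real l) * nb_coeff a l"
  have K: "?K \<ge> 0" using assms nb_coeff_ge_1[of a l] by simp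
  have "nb_mask a l 0 + ?K * 0 \<le> nb_mask a l y + ?K * y"
  proof (rule DERIV_nonneg_imp_nondecreasing[OF assms(2)])
    fix x assume x: "0 \<le> x" "x \<le> y"
    have "x ^ l * (1 - x) powr (a - 1) \<le> 1 * 1"
      using x assms by (intro mult_mono power_le_one powr_le1) auto
    then have "?K * (x ^ l * (1 - x) powr (a - 1)) \<le> ?K * 1"
      using K by (intro mult_left_mono) auto
    moreover have "((\<lambda>y. nb_mask a l y + ?K * y) has_real_derivative
        - (?K * x ^ l * (1 - x) powr (a - 1)) + ?K) (at x)"
      using x False assms by (auto intro!: derivative_eq_intros nb_mask_has_deriv)
    ultimately show "\<exists>d. ((\<lambda>y. nb_mask a l y + ?K * y) has_real_derivative d) (at x) \<and> 0 \<le> d"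
      by (intro exI conjI) (auto simp: mult.assoc)
  qed
  then show ?thesis by simp
qed

section \<open>The infinite product of masks\<close>

lemma ps_mask_bounds:
  assumes "a > 0"
  shows "0 \<le> ps_mask a l \<gamma>" "ps_mask a l \<gamma> \<le> 1"
  using assms
  by (auto simp: ps_mask_eq_nb_mask abs_square_le_1 intro!: nb_mask_nonneg nb_mask_le_1)

text \<open>Convergence is what gives \<open>prodinf\<close> its meaning as a limit of partial
  products. By \<open>nb_mask_ge\<close> and \<open>\<bar>sin x\<bar> \<le> \<bar>x\<bar>\<close>
  the distances of the factors from 1 are dominated by a geometric series of ratio 1/4.\<close>

lemma convergent_prod_ps_mask:
  assumes "a \<ge> 1"
  shows "convergent_prod (\<lambda>m. ps_mask a l (\<gamma> / 2 ^ Suc m))"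
proof -
  let ?K = "(a + real l) * nb_coeff a l"
  have K: "?K \<ge> 0" using assms nb_coeff_ge_1[of a l] by simp
  have "summable (\<lambda>m. norm (ps_mask a l (\<gamma> / 2 ^ Suc m) - 1))"
  proof (rule summable_comparison_test')
    \<comment> \<open>The separate factor 1/4 comes from the index shift
      \<open>Suc m\<close>.\<close>
    show "summable (\<lambda>m. ?K * (pi * \<gamma>)\<^sup>2 * (1/4) * (1/4) ^ m)"
      by (intro summable_mult summable_geometric) auto
    fix m :: nat
    let ?x = "pi * (\<gamma> / 2 ^ Suc m)"
    have "norm (ps_mask a l (\<gamma> / 2 ^ Suc m) - 1) = 1 - nb_mask a l ((sin ?x)\<^sup>2)"
      using ps_mask_bounds[of a l "\<gamma> / 2 ^ Suc m"] assms by (simp add: ps_mask_eq_nb_mask)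
    also have "\<dots> \<le> ?K * (sin ?x)\<^sup>2"
      using assms by (intro nb_mask_ge) (auto simp: abs_square_le_1)
    also have "\<dots> \<le> ?K * ?x\<^sup>2"
      by (intro mult_left_mono[OF _ K]) (simp only: abs_le_square_iff[symmetric] abs_sin_x_le_abs_x)
    also have "?x\<^sup>2 = (pi * \<gamma>)\<^sup>2 * (1/4) * (1/4) ^ m"
      by (simp add: power2_eq_square field_simps power_mult_distrib[symmetric])
    finally show "norm (norm (ps_mask a l (\<gamma> / 2 ^ Suc m) - 1))
        \<le> ?K * (pi * \<gamma>)\<^sup>2 * (1/4) * (1/4) ^ m"
      by (simp add: mult.assoc)
  qed
  then show ?thesis
    by (intro abs_convergent_prod_imp_convergent_prod summable_imp_abs_convergent_prod)
qed

text \<open>All factors lie between 0 and 1, so dropping the tail can only enlarge the product. For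
  \<open>n = 0\<close> this bounds the transform by 1.\<close>

lemma cmod_ps_hat_le_prod:
  assumes "a \<ge> 1"
  shows "cmod (ps_hat a l \<gamma>) \<le> (\<Prod>m<n. ps_mask a l (\<gamma> / 2 ^ Suc m))"
proof -
  let ?f = "\<lambda>m. ps_mask a l (\<gamma> / 2 ^ Suc m)"
  have f: "0 \<le> ?f m" "?f m \<le> 1" for m using assms by (auto intro!: ps_mask_bounds)
  have lim: "(\<lambda>n. \<Prod>i\<le>n. ?f i) \<longlonglongrightarrow> prodinf ?f"
    by (rule convergent_prod_LIMSEQ[OF convergent_prod_ps_mask[OF assms]])
  have "prodinf ?f \<ge> 0"
    using f by (intro LIMSEQ_le_const[OF lim]) (auto intro!: prod_nonneg)
  moreover have "prodinf ?f \<le> prod ?f {..<n}"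
  proof (intro LIMSEQ_le_const2[OF lim] exI[of _ n] allI impI)
    fix k assume "n \<le> k"
    then have "prod ?f {..k} = prod ?f {..<n} * prod ?f {n..k}"
      by (subst prod.union_disjoint[symmetric]) (auto intro!: prod.cong)
    also have "\<dots> \<le> prod ?f {..<n} * 1"
      using f by (intro mult_left_mono prod_le_1 prod_nonneg) auto
    finally show "prod ?f {..k} \<le> prod ?f {..<n}" by simp
  qed
  ultimately show ?thesis by (simp add: ps_hat_def)
qed

text \<open>The double angle formula applied \<open>n\<close> times; it evaluates the product of the
  cosines over \<open>n\<close> scales.\<close>

lemma sin_eq_prod_cos: "sin (x::real) = 2 ^ n * sin (x / 2 ^ n) * (\<Prod>i<n. cos (x / 2 ^ Suc i))"
proof (induction n)
  case (Suc n)
  have "sin (x / 2 ^ n) = 2 * sin (x / 2 ^ Suc n) * cos (x / 2 ^ Suc n)"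
    using sin_double[of "x / 2 ^ Suc n"] by simp
  with Suc show ?case by simp
qed auto

section \<open>The exponent and the decay over dyadic scales\<close>

lemma ps_kappa_powr:
  assumes "a \<ge> 1"
  shows "2 powr ps_kappa a l = nb_poly a l (3/4)"
  using assms nb_poly_ge_1[of a "3/4" l] by (simp add: ps_kappa_def ps_poly_eq_nb_poly)

text \<open>The mask at \<open>y = 3/4\<close> equals \<open>2 powr (ps_kappa a l - 2 * a)\<close>
  and is at most 1. Hence the decay exponent is never positive.\<close>

lemma ps_kappa_le:
  assumes "a \<ge> 1"
  shows "ps_kappa a l \<le> 2 * a"
proof -
  have "(1/4) powr a * nb_poly a l (3/4) \<le> 1"
    using nb_mask_le_1[of a "3/4" l] assms by (simp add: nb_mask_def)
  moreover have "(1/4::real) = 2 powr (-2)" by (simp add: powr_minus)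
  ultimately have "2 powr (ps_kappa a l - 2 * a) \<le> 2 powr 0"
    unfolding ps_kappa_powr[OF assms, symmetric]
    by (simp add: powr_powr powr_add[symmetric])
  then show ?thesis by (subst (asm) powr_le_cancel_iff) auto
qed

text \<open>At scale \<open>n\<close> the angle \<open>pi * \<bar>\<gamma>\<bar> / 2 ^ n\<close>
  lies between \<open>pi / 4\<close> and \<open>pi / 2\<close>, where the squared sine is at least
  1/2. The telescoped product of \<open>n\<close> squared cosines is then at most
  \<open>2 * (1/4) ^ n\<close>, which is the origin of \<open>2 powr a\<close>; the other factors
  are covered by \<open>nb_orbit_prod_le\<close>.\<close>

lemma ps_hat_dyadic_bound:
  assumes a: "a \<ge> 1" "real l \<le> a" and g: "1/4 \<le> \<bar>\<gamma>\<bar> / 2 ^ n" "\<bar>\<gamma>\<bar> / 2 ^ n \<le> 1/2"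
  shows "cmod (ps_hat a l \<gamma>) \<le> 2 powr a * nb_poly a l 1 * (2 ^ n) powr (- 2 * a + ps_kappa a l)"
proof -
  let ?x = "\<lambda>m. pi * \<gamma> / 2 ^ Suc m"
  define y where "y m = (sin (?x m))\<^sup>2" for m
  let ?Q = "nb_poly a l (3/4)" and ?M = "nb_poly a l 1"
  have Q: "?Q \<ge> 1" and M: "?M \<ge> 1" using a by (auto intro!: nb_poly_ge_1)
  have y01: "0 \<le> y i" "y i \<le> 1" for i by (auto simp: y_def abs_square_le_1)
  \<comment> \<open>Doubling the angle leads from \<open>Suc i\<close> to \<open>i\<close>, so the
    orbit runs from fine to coarse scales.\<close>
  have yrec: "y i = 4 * y (Suc i) * (1 - y (Suc i))" for i
  proof -
    have "sin (?x i) = 2 * sin (?x (Suc i)) * cos (?x (Suc i))"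
      using sin_double[of "?x (Suc i)"] by simp
    then show ?thesis unfolding y_def by (simp add: power_mult_distrib cos_squared_eq)
  qed
  have "(\<Prod>m<n. ps_mask a l (\<gamma> / 2 ^ Suc m))
      = (\<Prod>m<n. ((cos (?x m))\<^sup>2) powr a) * (\<Prod>m<n. nb_poly a l (y m))"
    using a by (simp add: ps_mask_eq_nb_mask nb_mask_def y_def cos_squared_eq prod.distrib)
  also have "(\<Prod>m<n. ((cos (?x m))\<^sup>2) powr a) = (\<Prod>m<n. (cos (?x m))\<^sup>2) powr a"
    by (subst prod_powr_distrib) auto
  also have "\<dots> * (\<Prod>m<n. nb_poly a l (y m)) \<le> (2 * (1/4) ^ n) powr a * (?M * ?Q ^ n)"
  proof (intro mult_mono powr_mono2)
    have pix: "pi / 4 \<le> pi * \<bar>\<gamma>\<bar> / 2 ^ n" "pi * \<bar>\<gamma>\<bar> / 2 ^ n \<le> pi / 2"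
      using g mult_left_mono[of "1/4" "\<bar>\<gamma>\<bar> / 2 ^ n" pi] mult_left_mono[of "\<bar>\<gamma>\<bar> / 2 ^ n" "1/2" pi]
      by auto
    have "sin (pi / 4) \<le> sin (pi * \<bar>\<gamma>\<bar> / 2 ^ n)"
      using pix pi_gt_zero by (subst sin_mono_le_eq) linarith+
    then have "(sin (pi / 4))\<^sup>2 \<le> (sin (pi * \<bar>\<gamma>\<bar> / 2 ^ n))\<^sup>2"
      by (intro power_mono) (auto simp: sin_45)
    then have "1/2 \<le> (sin (pi * \<bar>\<gamma>\<bar> / 2 ^ n))\<^sup>2"
      by (simp add: sin_45 power_divide)
    also have "\<dots> = (sin (pi * \<gamma> / 2 ^ n))\<^sup>2" by (cases "\<gamma> \<ge> 0") auto
    finally have s: "1/2 \<le> (sin (pi * \<gamma> / 2 ^ n))\<^sup>2" .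
    let ?P = "\<Prod>m<n. (cos (?x m))\<^sup>2"
    have P: "?P \<ge> 0" by (intro prod_nonneg) auto
    have "(4 ^ n * ?P) * (1/2) \<le> (4 ^ n * ?P) * (sin (pi * \<gamma> / 2 ^ n))\<^sup>2"
      using s P by (intro mult_left_mono) auto
    also have "\<dots> = (sin (pi * \<gamma>))\<^sup>2"
    proof -
      have "(2 ^ n)\<^sup>2 = (4::real) ^ n" by (simp add: power2_eq_square power_mult_distrib[symmetric])
      then show ?thesis
        by (subst (2) sin_eq_prod_cos[of _ n])
           (simp add: power_mult_distrib prod_power_distrib mult_ac)
    qed
    also have "\<dots> \<le> 1" by (simp add: abs_square_le_1)
    finally show "?P \<le> 2 * (1/4) ^ n" by (simp add: field_simps power_one_over)
    show "(\<Prod>m<n. nb_poly a l (y m)) \<le> ?M * ?Q ^ n"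
      using a(1) by (intro nb_orbit_prod_le[where y = y, OF _ a(2) y01 yrec]) simp
    show "0 \<le> (\<Prod>m<n. nb_poly a l (y m))"
      using a y01 by (intro prod_nonneg ballI order_trans[OF zero_le_one nb_poly_ge_1]) auto
  qed (use a in \<open>auto intro!: prod_nonneg\<close>)
  also have "\<dots> = 2 powr a * ?M * (2 ^ n) powr (- 2 * a + ps_kappa a l)"
  proof -
    have "(1/4::real) = 2 powr (- 2)" by (simp add: powr_minus)
    then have q1: "(1/4::real) ^ n = 2 powr (- 2 * real n)"
      by (simp only: powr_realpow[symmetric] powr_gt_zero powr_powr)
    have q2: "(2::real) ^ n = 2 powr real n" by (simp add: powr_realpow)
    have "?Q ^ n = (2 powr ps_kappa a l) powr real n"
      using Q by (simp add: ps_kappa_powr[OF a(1)] powr_realpow)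
    then show ?thesis unfolding q1 q2 powr_mult powr_powr
      by (simp add: powr_add[symmetric] algebra_simps)
  qed
  finally show ?thesis using cmod_ps_hat_le_prod[OF a(1), of l \<gamma> n] by linarith
qed

lemma ps_hat_decay:
  assumes a: "a \<ge> 1" "real l \<le> a"
  shows "\<exists>c>0. \<forall>\<gamma>. cmod (ps_hat a l \<gamma>) \<le> c * (1 + \<bar>\<gamma>\<bar>) powr (- 2 * a + ps_kappa a l)"
proof -
  define b where "b = 2 * a - ps_kappa a l"
  have b: "b \<ge> 0" using ps_kappa_le[OF a(1), of l] by (simp add: b_def)
  have bb: "- 2 * a + ps_kappa a l = - b" by (simp add: b_def)
  let ?C = "2 powr a * nb_poly a l 1"
  have "1 * 1 \<le> ?C" using a by (intro mult_mono nb_poly_ge_1 ge_one_powr_ge_zero) auto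
  then have C: "?C \<ge> 1" by simp
  let ?c = "?C * (3/2) powr b"
  have "cmod (ps_hat a l \<gamma>) \<le> ?c * (1 + \<bar>\<gamma>\<bar>) powr (- b)" for \<gamma>
  proof -
    \<comment> \<open>Here \<open>z\<close> is the scale compared with
      \<open>1 + \<bar>\<gamma>\<bar>\<close>: it is 1 for
      \<open>\<bar>\<gamma>\<bar> \<le> 1/2\<close>, and otherwise a power of 2 that is at least
      \<open>2 * \<bar>\<gamma>\<bar>\<close>. The factor 2/3 serves both cases, with equality
      possible at 1/2.\<close>
    have key: "cmod (ps_hat a l \<gamma>) \<le> ?c * (1 + \<bar>\<gamma>\<bar>) powr (- b)"
      if "z > 0" "2/3 * (1 + \<bar>\<gamma>\<bar>) \<le> z" "cmod (ps_hat a l \<gamma>) \<le> ?C * z powr (- b)" for z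
    proof -
      have "z powr (- b) \<le> (2/3 * (1 + \<bar>\<gamma>\<bar>)) powr (- b)"
        using that b by (intro powr_mono2') auto
      also have "\<dots> = (3/2) powr b * (1 + \<bar>\<gamma>\<bar>) powr (- b)"
        unfolding powr_mult by (simp add: powr_minus powr_divide)
      finally have "?C * z powr (- b) \<le> ?C * ((3/2) powr b * (1 + \<bar>\<gamma>\<bar>) powr (- b))"
        using C by (intro mult_left_mono) auto
      with that(3) show ?thesis by (simp only: mult.assoc order_trans)
    qed
    show ?thesis
    proof (cases "\<bar>\<gamma>\<bar> \<le> 1/2")
      case True
      have "cmod (ps_hat a l \<gamma>) \<le> 1" using cmod_ps_hat_le_prod[OF a(1), of l \<gamma> 0] by simp
      with C True show ?thesis by (intro key[of 1]) auto
    next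
      case False
      \<comment> \<open>The largest \<open>n\<close> with
        \<open>2 ^ n \<le> 4 * \<bar>\<gamma>\<bar>\<close>; it places
        \<open>\<bar>\<gamma>\<bar> / 2 ^ n\<close> between 1/4 and 1/2.\<close>
      define n where "n = nat \<lfloor>log 2 (4 * \<bar>\<gamma>\<bar>)\<rfloor>"
      have l0: "log 2 (4 * \<bar>\<gamma>\<bar>) \<ge> 0" using False by simp
      have n: "real n \<le> log 2 (4 * \<bar>\<gamma>\<bar>)" "log 2 (4 * \<bar>\<gamma>\<bar>) \<le> real n + 1"
        using l0 unfolding n_def by linarith+
      have n1: "2 ^ n \<le> 4 * \<bar>\<gamma>\<bar>"
        using n(1) False by (subst (asm) le_log_iff) (auto simp: powr_realpow)
      have n2: "4 * \<bar>\<gamma>\<bar> \<le> 2 ^ n * 2"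
        using n(2) False by (subst (asm) log_le_iff) (auto simp: powr_realpow powr_add)
      show ?thesis
      proof (intro key[of "2 ^ n"])
        show "cmod (ps_hat a l \<gamma>) \<le> ?C * (2 ^ n) powr (- b)"
          unfolding bb[symmetric] using n1 n2
          by (intro ps_hat_dyadic_bound[OF a]) (auto simp: field_simps)
      qed (use n2 False in auto)
    qed
  qed
  moreover have "?c > 0" using less_le_trans[OF zero_less_one C] by (simp only: mult_pos_pos powr_gt_zero)
  ultimately show ?thesis unfolding bb by blast
qed

section \<open>Fourier inversion in L2\<close>

lemma borel_measurable_cis [measurable]: "cis \<in> borel_measurable borel"
  by (intro borel_measurable_continuous_onI continuous_intros)

lemma fourier_eq_cis: "fourier f \<gamma> = (LINT t|lborel. f t * cis (- (2 * pi * t * \<gamma>)))"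
  unfolding fourier_def by (intro Bochner_Integration.integral_cong) (auto simp: cis_conv_exp mult_ac)

lemma integrable_mult_bounded:
  fixes f g :: "real \<Rightarrow> complex"
  assumes f: "integrable lborel f" and [measurable]: "g \<in> borel_measurable lborel"
    and g: "\<And>x. cmod (g x) \<le> C"
  shows "integrable lborel (\<lambda>x. f x * g x)"
proof (rule Bochner_Integration.integrable_bound)
  show "integrable lborel (\<lambda>x. C * norm (f x))" using f by simp
  show "(\<lambda>x. f x * g x) \<in> borel_measurable lborel" using f by measurable
  have C: "C \<ge> 0" using g[of 0] norm_ge_zero[of "g 0"] by linarith
  have "norm (f x * g x) \<le> norm (C * norm (f x))" for x
    using mult_right_mono[OF g[of x], of "cmod (f x)"] C by (simp add: norm_mult mult.commute)
  then show "AE x in lborel. norm (f x * g x) \<le> norm (C * norm (f x))" by simp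
qed

text \<open>The product of the norms of \<open>f\<close> and \<open>h\<close> is an integrable
  majorant on the plane. With a character as kernel this is the multiplication formula, which moves
  the Fourier transform from one factor to the other.\<close>

lemma Fubini_bounded_kernel:
  fixes f h :: "real \<Rightarrow> complex" and K :: "real \<Rightarrow> real \<Rightarrow> complex"
  assumes f: "integrable lborel f" and h: "integrable lborel h"
    and K [measurable]: "case_prod K \<in> borel_measurable (lborel \<Otimes>\<^sub>M lborel)"
    and K1: "\<And>x y. cmod (K x y) \<le> 1"
  shows "(LINT x|lborel. f x * (LINT y|lborel. h y * K x y))
    = (LINT y|lborel. h y * (LINT x|lborel. f x * K x y))"
proof -
  note [measurable] = borel_measurable_integrable[OF f] borel_measurable_integrable[OF h]
  have K': "(\<lambda>y. K x y) \<in> borel_measurable lborel" for x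
    using measurable_Pair2[OF K, of x] by simp
  have meas: "(\<lambda>(x, y). f x * (h y * K x y)) \<in> borel_measurable (lborel \<Otimes>\<^sub>M lborel)"
    by measurable
  have int: "integrable (lborel \<Otimes>\<^sub>M lborel) (\<lambda>(x, y). f x * (h y * K x y))"
  proof (rule Bochner_Integration.integrable_bound[OF _ meas])
    show "integrable (lborel \<Otimes>\<^sub>M lborel) (\<lambda>(x, y). norm (f x) * norm (h y))"
      using f h by (intro lborel_pair.Fubini_integrable) (auto simp: norm_mult)
    have "norm (f x * (h y * K x y)) \<le> norm (f x) * (norm (h y) * 1)" for x y
      using K1[of x y] unfolding norm_mult by (intro mult_left_mono) auto
    then show "AE p in lborel \<Otimes>\<^sub>M lborel. norm (case p of (x, y) \<Rightarrow> f x * (h y * K x y))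
        \<le> norm (case p of (x, y) \<Rightarrow> norm (f x) * norm (h y))"
      by (auto intro!: AE_I2)
  qed
  have "(LINT x|lborel. f x * (LINT y|lborel. h y * K x y))
      = (LINT x|lborel. LINT y|lborel. f x * (h y * K x y))" by simp
  also have "\<dots> = (LINT y|lborel. LINT x|lborel. f x * (h y * K x y))"
    by (rule lborel_pair.Fubini_integral[OF int, symmetric])
  also have "\<dots> = (LINT y|lborel. LINT x|lborel. h y * (f x * K x y))"
    by (simp add: mult_ac)
  finally show ?thesis by simp
qed

lemma integrable_mult_L2:
  assumes "a \<in> L2" "b \<in> L2"
  shows "integrable lborel (\<lambda>x. a x * b x)"
proof (rule Bochner_Integration.integrable_bound)
  show "integrable lborel (\<lambda>x. (cmod (a x))\<^sup>2 + (cmod (b x))\<^sup>2)"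
    using assms by (simp add: L2_def)
  show "(\<lambda>x. a x * b x) \<in> borel_measurable lborel"
    using assms by (auto simp: L2_def)
  have "norm (a x * b x) \<le> norm ((cmod (a x))\<^sup>2 + (cmod (b x))\<^sup>2)" for x
  proof -
    have "0 \<le> cmod (a x) * cmod (b x)" by simp
    then have "cmod (a x) * cmod (b x) \<le> (cmod (a x))\<^sup>2 + (cmod (b x))\<^sup>2"
      using sum_squares_bound[of "cmod (a x)" "cmod (b x)"] by linarith
    then show ?thesis by (simp add: norm_mult)
  qed
  then show "AE x in lborel. norm (a x * b x) \<le> norm ((cmod (a x))\<^sup>2 + (cmod (b x))\<^sup>2)"
    by simp
qed

text \<open>Cauchy-Schwarz applied to the difference \<open>F n - f\<close>. Integrability of the
  products is a separate assumption, so that the sequence may consist of functions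
  \<open>fourier (F n)\<close>, for which boundedness is at hand rather than membership in
  L2.\<close>

lemma tendsto_integral_mult_L2:
  fixes F :: "nat \<Rightarrow> real \<Rightarrow> complex"
  assumes F: "\<And>n. integrable lborel (\<lambda>x. F n x * u x)" and f: "integrable lborel (\<lambda>x. f x * u x)"
    and [measurable]: "\<And>n. F n \<in> borel_measurable lborel" "f \<in> borel_measurable lborel"
    and u: "u \<in> L2"
    and lim: "(\<lambda>n. \<integral>\<^sup>+ x. ennreal ((cmod (F n x - f x))\<^sup>2) \<partial>lborel) \<longlonglongrightarrow> 0"
  shows "(\<lambda>n. LINT x|lborel. F n x * u x) \<longlonglongrightarrow> (LINT x|lborel. f x * u x)"
proof -
  have [measurable]: "u \<in> borel_measurable lborel" using u by (simp add: L2_def)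
  let ?U = "\<integral>\<^sup>+ x. ennreal ((cmod (u x))\<^sup>2) \<partial>lborel"
  have U: "?U < \<infinity>"
    using u by (simp add: L2_def integrable_iff_bounded)
  have bound: "ennreal ((norm ((LINT x|lborel. F n x * u x) - (LINT x|lborel. f x * u x)))\<^sup>2)
      \<le> (\<integral>\<^sup>+ x. ennreal ((cmod (F n x - f x))\<^sup>2) \<partial>lborel) * ?U" for n
  proof -
    have "(LINT x|lborel. F n x * u x) - (LINT x|lborel. f x * u x)
        = (LINT x|lborel. F n x * u x - f x * u x)"
      using F f by (intro Bochner_Integration.integral_diff[symmetric])
    moreover have "ennreal (norm (LINT x|lborel. F n x * u x - f x * u x))
        \<le> (\<integral>\<^sup>+ x. norm (F n x * u x - f x * u x) \<partial>lborel)"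
      using F f by (intro integral_norm_bound_ennreal Bochner_Integration.integrable_diff)
    moreover have "(\<integral>\<^sup>+ x. norm (F n x * u x - f x * u x) \<partial>lborel)
        = (\<integral>\<^sup>+ x. ennreal (cmod (F n x - f x)) * ennreal (cmod (u x)) \<partial>lborel)"
      by (intro nn_integral_cong)
         (simp add: ennreal_mult[symmetric] norm_mult[symmetric] left_diff_distrib)
    ultimately have "ennreal (norm ((LINT x|lborel. F n x * u x) - (LINT x|lborel. f x * u x))) ^ 2
        \<le> (\<integral>\<^sup>+ x. ennreal (cmod (F n x - f x)) * ennreal (cmod (u x)) \<partial>lborel) ^ 2"
      by (intro power_mono) auto
    also have "\<dots> \<le> (\<integral>\<^sup>+ x. ennreal (cmod (F n x - f x)) ^ 2 \<partial>lborel)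
        * (\<integral>\<^sup>+ x. ennreal (cmod (u x)) ^ 2 \<partial>lborel)"
      by (rule Cauchy_Schwarz_nn_integral) measurable
    finally show ?thesis by (simp add: ennreal_power)
  qed
  have "(\<lambda>n. (\<integral>\<^sup>+ x. ennreal ((cmod (F n x - f x))\<^sup>2) \<partial>lborel) * ?U) \<longlonglongrightarrow> 0 * ?U"
    using U by (intro tendsto_mult_ennreal[OF lim] tendsto_const) auto
  then have "(\<lambda>n. (\<integral>\<^sup>+ x. ennreal ((cmod (F n x - f x))\<^sup>2) \<partial>lborel) * ?U) \<longlonglongrightarrow> 0"
    by simp
  from tendsto_sandwich[OF _ _ tendsto_const this]
  have "(\<lambda>n. ennreal ((norm ((LINT x|lborel. F n x * u x) - (LINT x|lborel. f x * u x)))\<^sup>2)) \<longlonglongrightarrow> ennreal 0"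
    using bound by simp
  then have "(\<lambda>n. (norm ((LINT x|lborel. F n x * u x) - (LINT x|lborel. f x * u x)))\<^sup>2) \<longlonglongrightarrow> 0"
    by (subst (asm) tendsto_ennreal_iff) auto
  then have "(\<lambda>n. norm ((LINT x|lborel. F n x * u x) - (LINT x|lborel. f x * u x))) \<longlonglongrightarrow> 0"
    by (subst (asm) power_tendsto_0_iff) auto
  then show ?thesis by (simp add: tendsto_norm_zero_iff LIM_zero_iff)
qed

section \<open>Uniqueness of the Fourier transform of integrable functions\<close>

lemma fourier_unique_real:
  fixes v :: "real \<Rightarrow> real"
  assumes v: "integrable lborel v"
    and zero: "\<And>t. (LINT x|lborel. v x * cis (t * x)) = 0"
  shows "AE x in lborel. v x = 0"
proof -
  note [measurable] = borel_measurable_integrable[OF v]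
  \<comment> \<open>Positive and negative part have equal Fourier integrals, and frequency 0 shows
    that they have the same mass. If the mass is positive, dividing by it gives two probability
    densities with equal characteristic functions; if it is 0, both parts vanish almost
    everywhere.\<close>
  define p where "p x = max 0 (v x)" for x
  define q where "q x = max 0 (- v x)" for x
  have pq: "integrable lborel p" "integrable lborel q"
    using v by (auto simp: p_def[abs_def] q_def[abs_def])
  note [measurable] = borel_measurable_integrable[OF pq(1)] borel_measurable_integrable[OF pq(2)]
  have v_eq: "v x = p x - q x" for x by (simp add: p_def q_def)
  have pos: "p x \<ge> 0" "q x \<ge> 0" for x by (auto simp: p_def q_def)
  have eq: "(LINT x|lborel. p x * cis (t * x)) = (LINT x|lborel. q x * cis (t * x))" for t
  proof -
    have int: "integrable lborel (\<lambda>x. r x * cis (t * x))" if "integrable lborel r" for r :: "real \<Rightarrow> real"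
      using that by (intro integrable_mult_bounded[where C = 1]) auto
    have "(LINT x|lborel. p x * cis (t * x)) - (LINT x|lborel. q x * cis (t * x))
        = (LINT x|lborel. p x * cis (t * x) - q x * cis (t * x))"
      by (intro Bochner_Integration.integral_diff[symmetric] int pq)
    also have "\<dots> = (LINT x|lborel. v x * cis (t * x))"
      by (simp add: v_eq left_diff_distrib)
    finally show ?thesis using zero by simp
  qed
  define m where "m = (LINT x|lborel. p x)"
  have "complex_of_real (LINT x|lborel. p x) = complex_of_real (LINT x|lborel. q x)"
    using eq[of 0] by simp
  then have m: "(LINT x|lborel. p x) = m" "(LINT x|lborel. q x) = m" by (simp_all add: m_def)
  have "m \<ge> 0" unfolding m_def by (intro Bochner_Integration.integral_nonneg pos)
  then consider "m = 0" | "m > 0" by linarith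
  then show ?thesis
  proof cases
    case 1
    then have "AE x in lborel. p x = 0" "AE x in lborel. q x = 0"
      using m pq pos by (auto simp: integral_nonneg_eq_0_iff_AE)
    then show ?thesis by eventually_elim (simp add: v_eq)
  next
    case 2
    have dist: "real_distribution (density lborel (\<lambda>x. ennreal (r x / m)))"
      if r: "integrable lborel r" "\<And>x. r x \<ge> 0" "(LINT x|lborel. r x) = m" for r :: "real \<Rightarrow> real"
    proof -
      have [measurable]: "r \<in> borel_measurable lborel" using r by measurable
      have "(\<integral>\<^sup>+ x. ennreal (r x / m) \<partial>lborel) = ennreal (LINT x|lborel. r x / m)"
        using r 2 by (intro nn_integral_eq_integral) auto
      also have "\<dots> = 1" using r 2 by simp
      finally have "emeasure (density lborel (\<lambda>x. ennreal (r x / m)))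
          (space (density lborel (\<lambda>x. ennreal (r x / m)))) = 1"
        by (simp add: emeasure_density)
      then show ?thesis
        by (intro real_distribution.intro real_distribution_axioms.intro prob_spaceI) auto
    qed
    have char: "char (density lborel (\<lambda>x. ennreal (r x / m))) t
        = (LINT x|lborel. r x * cis (t * x)) / m"
      if r: "integrable lborel r" "\<And>x. r x \<ge> 0" for r :: "real \<Rightarrow> real" and t
    proof -
      have [measurable]: "r \<in> borel_measurable lborel" using r by measurable
      have "char (density lborel (\<lambda>x. ennreal (r x / m))) t
          = (LINT x|lborel. (r x / m) *\<^sub>R iexp (t * x))"
        unfolding char_def using r 2 by (intro integral_density) auto
      also have "\<dots> = (LINT x|lborel. r x * cis (t * x) / m)"
        by (intro Bochner_Integration.integral_cong) (auto simp: cis_conv_exp scaleR_conv_of_real)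
      finally show ?thesis by simp
    qed
    have "density lborel (\<lambda>x. ennreal (p x / m)) = density lborel (\<lambda>x. ennreal (q x / m))"
      using pq pos m eq by (intro Levy_uniqueness dist ext) (simp_all add: char)
    then have "AE x in lborel. ennreal (p x / m) = ennreal (q x / m)"
      by (intro sigma_finite_measure.density_unique[OF sigma_finite_lborel]) auto
    then show ?thesis
    proof eventually_elim
      case (elim x)
      then have "p x / m = q x / m" using pos 2 by (subst (asm) ennreal_inj) auto
      then show ?case using 2 by (simp add: v_eq)
    qed
  qed
qed

text \<open>The transform of \<open>cnj w\<close> at \<open>t\<close> is the conjugate of that of
  \<open>w\<close> at \<open>- t\<close>, so the transform of the real part
  \<open>(w + cnj w) / 2\<close> vanishes too. The imaginary part is the real part of
  \<open>- \<i> * w\<close>.\<close>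

lemma fourier_unique:
  fixes w :: "real \<Rightarrow> complex"
  assumes w: "integrable lborel w"
    and zero: "\<And>t. (LINT x|lborel. w x * cis (t * x)) = 0"
  shows "AE x in lborel. w x = 0"
proof -
  have Re: "AE x in lborel. Re (w x) = 0"
    if w: "integrable lborel w" and zero: "\<And>t. (LINT x|lborel. w x * cis (t * x)) = 0"
    for w :: "real \<Rightarrow> complex"
  proof (rule fourier_unique_real)
    show "integrable lborel (\<lambda>x. Re (w x))" using w by simp
    fix t
    have int: "integrable lborel (\<lambda>x. w x * cis (t * x))" for t
      using w by (intro integrable_mult_bounded[where C = 1]) auto
    have "(LINT x|lborel. cnj (w x * cis (- t * x))) = cnj (LINT x|lborel. w x * cis (- t * x))"
      by (rule Bochner_Integration.integral_cnj)
    then have c: "(LINT x|lborel. cnj (w x) * cis (t * x)) = 0"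
      using zero[of "- t"] by (simp add: cis_cnj)
    have ic: "integrable lborel (\<lambda>x. cnj (w x) * cis (t * x))"
      using w by (intro integrable_mult_bounded[where C = 1]) auto
    have "complex_of_real (Re (w x)) * cis (t * x)
        = (w x * cis (t * x) + cnj (w x) * cis (t * x)) / 2" for x
      by (simp add: distrib_right[symmetric] complex_add_cnj)
    then have "(LINT x|lborel. complex_of_real (Re (w x)) * cis (t * x))
        = (LINT x|lborel. (w x * cis (t * x) + cnj (w x) * cis (t * x)) / 2)"
      by (simp only:)
    also have "\<dots> = (LINT x|lborel. w x * cis (t * x) + cnj (w x) * cis (t * x)) / 2"
      by (rule integral_divide_zero)
    also have "\<dots> = 0"
      by (subst Bochner_Integration.integral_add[OF int ic]) (simp add: zero c)
    finally show "(LINT x|lborel. complex_of_real (Re (w x)) * cis (t * x)) = 0" .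
  qed
  have "(LINT x|lborel. (- \<i> * w x) * cis (t * x)) = - \<i> * (LINT x|lborel. w x * cis (t * x))" for t
    by (subst integral_mult_right_zero[symmetric]) (simp add: mult.assoc)
  then have "AE x in lborel. Re (- \<i> * w x) = 0"
    using w zero by (intro Re) auto
  with Re[OF w zero] show ?thesis
    by eventually_elim (simp add: complex_eq_iff)
qed

section \<open>Gaussian test functions\<close>

lemma integrable_gaussian: "integrable lborel (\<lambda>x. exp (- x\<^sup>2 / 2) :: real)"
proof -
  have "integrable lborel (\<lambda>x. sqrt (2 * pi) * std_normal_density x)"
    by (intro integrable_mult_right integrable_normal_density) auto
  then show ?thesis by (simp add: std_normal_density_def)
qed

lemma integral_std_normal_cis:
  "(LINT x|lborel. complex_of_real (std_normal_density x) * cis (t * x)) = complex_of_real (exp (- t\<^sup>2 / 2))"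
proof -
  have "complex_of_real (exp (- t\<^sup>2 / 2)) = char std_normal_distribution t"
    by (simp add: char_std_normal_distribution)
  also have "\<dots> = (LINT x|lborel. std_normal_density x *\<^sub>R iexp (t * x))"
    unfolding char_def by (intro integral_density) auto
  finally show ?thesis by (simp add: cis_conv_exp scaleR_conv_of_real)
qed

definition inv_fourier :: "(real \<Rightarrow> complex) \<Rightarrow> real \<Rightarrow> complex" where
  "inv_fourier g x = (LINT \<gamma>|lborel. g \<gamma> * cis (2 * pi * x * \<gamma>))"

text \<open>The phase is chosen such that \<open>gauss_wave \<xi>\<close> has the inverse transform
  \<open>gauss_shift \<xi>\<close>, a Gaussian centred at \<open>\<xi>\<close>, and is in turn its
  Fourier transform. Both facts are computed from the characteristic function of the normal
  distribution.\<close>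

definition gauss_wave :: "real \<Rightarrow> real \<Rightarrow> complex" where
  "gauss_wave \<xi> x = complex_of_real (std_normal_density x) * cis (- (2 * pi * x * \<xi>))"

definition gauss_shift :: "real \<Rightarrow> real \<Rightarrow> complex" where
  "gauss_shift \<xi> \<gamma> = complex_of_real (exp (- (2 * pi * (\<gamma> - \<xi>))\<^sup>2 / 2))"

lemma gauss_wave_measurable [measurable]: "gauss_wave \<xi> \<in> borel_measurable borel"
  unfolding gauss_wave_def[abs_def] by measurable

lemma gauss_shift_measurable [measurable]: "gauss_shift \<xi> \<in> borel_measurable borel"
  unfolding gauss_shift_def[abs_def] by measurable

lemma cmod_gauss_wave: "cmod (gauss_wave \<xi> x) = std_normal_density x"
  by (simp add: gauss_wave_def norm_mult)

lemma std_normal_density_le_1: "std_normal_density x \<le> 1"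
proof -
  have "1 \<le> sqrt (2 * pi)" using pi_ge_two by (intro real_le_rsqrt) simp
  then have "1 / sqrt (2 * pi) * exp (- x\<^sup>2 / 2) \<le> 1 * 1"
    by (intro mult_mono) auto
  then show ?thesis by (simp add: std_normal_density_def)
qed

lemma cmod_gauss_shift_le_1: "cmod (gauss_shift \<xi> \<gamma>) \<le> 1"
  by (simp add: gauss_shift_def)

lemma integrable_gauss_wave: "integrable lborel (gauss_wave \<xi>)"
proof -
  have "integrable lborel (\<lambda>x. complex_of_real (std_normal_density x))"
    by (intro integrable_of_real integrable_normal_density) auto
  then show ?thesis
    unfolding gauss_wave_def[abs_def]
    by (intro integrable_mult_bounded[where C = 1]) auto
qed

lemma integrable_gauss_shift: "integrable lborel (gauss_shift \<xi>)"
proof -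
  have "integrable lborel (\<lambda>\<gamma>. exp (- (- (2 * pi * \<xi>) + 2 * pi * \<gamma>)\<^sup>2 / 2) :: real)"
    using integrable_gaussian by (intro lborel_integrable_real_affine) auto
  then have "integrable lborel (\<lambda>\<gamma>. complex_of_real (exp (- (- (2 * pi * \<xi>) + 2 * pi * \<gamma>)\<^sup>2 / 2)))"
    by (rule integrable_of_real)
  then show ?thesis
    unfolding gauss_shift_def[abs_def] by (simp add: right_diff_distrib)
qed

lemma L2_of_bounded_integrable:
  assumes f: "integrable lborel f" and b: "\<And>x. cmod (f x) \<le> 1"
  shows "f \<in> L2"
proof -
  note [measurable] = borel_measurable_integrable[OF f]
  have "integrable lborel (\<lambda>x. (cmod (f x))\<^sup>2)"
  proof (rule Bochner_Integration.integrable_bound[OF f])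
    have "(cmod (f x))\<^sup>2 \<le> cmod (f x)" for x
      using mult_left_mono[OF b[of x], of "cmod (f x)"] by (simp add: power2_eq_square)
    then show "AE x in lborel. norm ((cmod (f x))\<^sup>2) \<le> norm (f x)" by simp
  qed measurable
  then show ?thesis by (simp add: L2_def)
qed

lemma inv_fourier_gauss_wave: "inv_fourier (gauss_wave \<xi>) \<gamma> = gauss_shift \<xi> \<gamma>"
proof -
  have "inv_fourier (gauss_wave \<xi>) \<gamma>
      = (LINT x|lborel. complex_of_real (std_normal_density x) * cis ((2 * pi * (\<gamma> - \<xi>)) * x))"
    unfolding inv_fourier_def gauss_wave_def
    by (intro Bochner_Integration.integral_cong refl)
       (simp add: cis_mult mult.assoc algebra_simps)
  then show ?thesis unfolding integral_std_normal_cis gauss_shift_def .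
qed

text \<open>The substitution \<open>\<gamma> = \<xi> + y / (2 * pi)\<close> leads back to the
  standard Gaussian. The Jacobian \<open>1 / (2 * pi)\<close> times the normalization
  \<open>sqrt (2 * pi)\<close> is the prefactor \<open>1 / sqrt (2 * pi)\<close> of the
  density.\<close>

lemma fourier_gauss_shift: "fourier (gauss_shift \<xi>) x = gauss_wave \<xi> x"
proof -
  have "fourier (gauss_shift \<xi>) x
      = (LINT \<gamma>|lborel. complex_of_real (exp (- (2 * pi * (\<gamma> - \<xi>))\<^sup>2 / 2)) * cis (- (2 * pi * \<gamma> * x)))"
    unfolding fourier_eq_cis gauss_shift_def ..
  also have "\<dots> = \<bar>1 / (2 * pi)\<bar> *\<^sub>R (LINT y|lborel. complex_of_real
      (exp (- (2 * pi * ((\<xi> + 1 / (2 * pi) * y) - \<xi>))\<^sup>2 / 2)) * cis (- (2 * pi * (\<xi> + 1 / (2 * pi) * y) * x)))"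
    by (rule lborel_integral_real_affine) simp
  also have "(\<lambda>y. complex_of_real
      (exp (- (2 * pi * ((\<xi> + 1 / (2 * pi) * y) - \<xi>))\<^sup>2 / 2)) * cis (- (2 * pi * (\<xi> + 1 / (2 * pi) * y) * x)))
      = (\<lambda>y. (sqrt (2 * pi) * cis (- (2 * pi * x * \<xi>)))
          * (complex_of_real (std_normal_density y) * cis (- x * y)))"
  proof
    fix y
    have "- (2 * pi * (\<xi> + 1 / (2 * pi) * y) * x) = - (2 * pi * x * \<xi>) + - x * y"
      by (simp add: field_simps)
    then have "cis (- (2 * pi * (\<xi> + 1 / (2 * pi) * y) * x)) = cis (- (2 * pi * x * \<xi>)) * cis (- x * y)"
      by (simp only: cis_mult)
    moreover have "exp (- (2 * pi * ((\<xi> + 1 / (2 * pi) * y) - \<xi>))\<^sup>2 / 2)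
        = sqrt (2 * pi) * std_normal_density y"
      by (simp add: std_normal_density_def)
    ultimately show "complex_of_real
      (exp (- (2 * pi * ((\<xi> + 1 / (2 * pi) * y) - \<xi>))\<^sup>2 / 2)) * cis (- (2 * pi * (\<xi> + 1 / (2 * pi) * y) * x))
      = (sqrt (2 * pi) * cis (- (2 * pi * x * \<xi>)))
          * (complex_of_real (std_normal_density y) * cis (- x * y))"
      by (simp only: of_real_mult mult_ac)
  qed
  also have "(LINT y|lborel. (sqrt (2 * pi) * cis (- (2 * pi * x * \<xi>)))
          * (complex_of_real (std_normal_density y) * cis (- x * y)))
      = (sqrt (2 * pi) * cis (- (2 * pi * x * \<xi>))) * complex_of_real (exp (- x\<^sup>2 / 2))"
    by (subst integral_mult_right_zero) (simp add: integral_std_normal_cis[of "- x", simplified])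
  also have "\<bar>1 / (2 * pi)\<bar> *\<^sub>R \<dots> = gauss_wave \<xi> x"
  proof -
    have "sqrt (2 * pi) * sqrt (2 * pi) = 2 * pi" by simp
    then have "1 / (2 * pi) * sqrt (2 * pi) = 1 / sqrt (2 * pi)"
      by (simp add: field_simps)
    then have "1 / (2 * pi) * sqrt (2 * pi) * exp (- x\<^sup>2 / 2) = std_normal_density x"
      by (simp add: std_normal_density_def)
    then have density: "complex_of_real (std_normal_density x)
        = complex_of_real (1 / (2 * pi)) * complex_of_real (sqrt (2 * pi)) * complex_of_real (exp (- x\<^sup>2 / 2))"
      by (simp only: of_real_mult[symmetric])
    have "\<bar>1 / (2 * pi)\<bar> = 1 / (2 * pi)" by simp
    then show ?thesis
      unfolding gauss_wave_def scaleR_conv_of_real density by (simp only: mult_ac)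
  qed
  finally show ?thesis .
qed

section \<open>Inversion for integrable transforms\<close>

lemma cmod_inv_fourier_le:
  assumes "integrable lborel g"
  shows "cmod (inv_fourier g x) \<le> (LINT \<gamma>|lborel. cmod (g \<gamma>))"
proof -
  have "cmod (inv_fourier g x) \<le> (LINT \<gamma>|lborel. cmod (g \<gamma> * cis (2 * pi * x * \<gamma>)))"
    unfolding inv_fourier_def by (rule integral_norm_bound)
  then show ?thesis by (simp add: norm_mult)
qed

lemma inv_fourier_measurable:
  assumes [measurable]: "g \<in> borel_measurable lborel"
  shows "inv_fourier g \<in> borel_measurable lborel"
  unfolding inv_fourier_def[abs_def] by measurable

lemma cmod_fourier_le: "cmod (fourier f \<gamma>) \<le> (LINT t|lborel. cmod (f t))"
proof -
  have "cmod (fourier f \<gamma>) \<le> (LINT t|lborel. cmod (f t * cis (- (2 * pi * t * \<gamma>))))"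
    unfolding fourier_eq_cis by (rule integral_norm_bound)
  then show ?thesis by (simp add: norm_mult)
qed

lemma fourier_measurable:
  assumes [measurable]: "f \<in> borel_measurable lborel"
  shows "fourier f \<in> borel_measurable lborel"
  unfolding fourier_eq_cis[abs_def] by measurable

lemma L2_fourier_inversion:
  assumes fg: "has_L2_fourier f g" and g: "integrable lborel g"
  shows "AE x in lborel. f x = inv_fourier g x"
proof -
  from fg obtain F :: "nat \<Rightarrow> real \<Rightarrow> complex" where f2: "f \<in> L2" and g2: "g \<in> L2"
    and F2: "\<And>n. F n \<in> L2" and F1: "\<And>n. integrable lborel (F n)"
    and lim1: "(\<lambda>n. \<integral>\<^sup>+ x. ennreal ((cmod (F n x - f x))\<^sup>2) \<partial>lborel) \<longlonglongrightarrow> 0"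
    and lim2: "(\<lambda>n. \<integral>\<^sup>+ \<gamma>. ennreal ((cmod (fourier (F n) \<gamma> - g \<gamma>))\<^sup>2) \<partial>lborel) \<longlonglongrightarrow> 0"
    unfolding has_L2_fourier_def by blast
  have [measurable]: "f \<in> borel_measurable lborel" "g \<in> borel_measurable lborel"
    "F n \<in> borel_measurable lborel" "fourier (F n) \<in> borel_measurable lborel"
    "inv_fourier g \<in> borel_measurable lborel" for n
    using f2 g2 F2 fourier_measurable[of "F n"] inv_fourier_measurable[of g]
    by (auto simp: L2_def)
  have wave: "gauss_wave \<xi> \<in> L2" for \<xi>
    by (intro L2_of_bounded_integrable integrable_gauss_wave)
       (simp add: cmod_gauss_wave std_normal_density_le_1)
  have shift: "gauss_shift \<xi> \<in> L2" for \<xi>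
    by (intro L2_of_bounded_integrable integrable_gauss_shift cmod_gauss_shift_le_1)
  \<comment> \<open>For each \<open>F n\<close> the two integrals agree by the multiplication
    formula; both sides then converge by \<open>tendsto_integral_mult_L2\<close>.\<close>
  have parseval: "(LINT x|lborel. f x * gauss_wave \<xi> x) = (LINT \<gamma>|lborel. g \<gamma> * gauss_shift \<xi> \<gamma>)" for \<xi>
  proof (rule LIMSEQ_unique)
    show "(\<lambda>n. LINT x|lborel. F n x * gauss_wave \<xi> x) \<longlonglongrightarrow> (LINT x|lborel. f x * gauss_wave \<xi> x)"
      by (rule tendsto_integral_mult_L2[OF _ _ _ _ wave lim1])
         (auto intro!: integrable_mult_L2 F2 f2 wave)
    have "(LINT x|lborel. F n x * gauss_wave \<xi> x)
        = (LINT \<gamma>|lborel. fourier (F n) \<gamma> * gauss_shift \<xi> \<gamma>)" for n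
    proof -
      have "(LINT x|lborel. F n x * (LINT \<gamma>|lborel. gauss_shift \<xi> \<gamma> * cis (- (2 * pi * x * \<gamma>))))
          = (LINT \<gamma>|lborel. gauss_shift \<xi> \<gamma> * (LINT x|lborel. F n x * cis (- (2 * pi * x * \<gamma>))))"
        by (intro Fubini_bounded_kernel F1 integrable_gauss_shift) auto
      moreover have "(LINT \<gamma>|lborel. gauss_shift \<xi> \<gamma> * cis (- (2 * pi * x * \<gamma>))) = gauss_wave \<xi> x" for x
        using fourier_gauss_shift[of \<xi> x] unfolding fourier_eq_cis by (simp add: mult_ac)
      ultimately show ?thesis unfolding fourier_eq_cis by (simp add: mult.commute[of "gauss_shift \<xi> _"])
    qed
    moreover have "(\<lambda>n. LINT \<gamma>|lborel. fourier (F n) \<gamma> * gauss_shift \<xi> \<gamma>)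
        \<longlonglongrightarrow> (LINT \<gamma>|lborel. g \<gamma> * gauss_shift \<xi> \<gamma>)"
    proof (rule tendsto_integral_mult_L2[OF _ _ _ _ shift lim2])
      show "integrable lborel (\<lambda>x. fourier (F n) x * gauss_shift \<xi> x)" for n
        unfolding mult.commute[of "fourier (F n) _"]
        by (rule integrable_mult_bounded[OF integrable_gauss_shift _ cmod_fourier_le]) measurable
    qed (auto intro!: integrable_mult_L2 g2 shift)
    ultimately show "(\<lambda>n. LINT x|lborel. F n x * gauss_wave \<xi> x)
        \<longlonglongrightarrow> (LINT \<gamma>|lborel. g \<gamma> * gauss_shift \<xi> \<gamma>)" by simp
  qed
  have inv: "(LINT x|lborel. inv_fourier g x * gauss_wave \<xi> x) = (LINT \<gamma>|lborel. g \<gamma> * gauss_shift \<xi> \<gamma>)" for \<xi>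
  proof -
    have "(LINT x|lborel. gauss_wave \<xi> x * (LINT \<gamma>|lborel. g \<gamma> * cis (2 * pi * x * \<gamma>)))
        = (LINT \<gamma>|lborel. g \<gamma> * (LINT x|lborel. gauss_wave \<xi> x * cis (2 * pi * x * \<gamma>)))"
      by (intro Fubini_bounded_kernel g integrable_gauss_wave) auto
    moreover have "(LINT x|lborel. gauss_wave \<xi> x * cis (2 * pi * x * \<gamma>)) = gauss_shift \<xi> \<gamma>" for \<gamma>
      using inv_fourier_gauss_wave[of \<xi> \<gamma>] unfolding inv_fourier_def by (simp add: mult_ac)
    ultimately show ?thesis unfolding inv_fourier_def by (simp add: mult.commute[of "gauss_wave \<xi> _"])
  qed
  \<comment> \<open>The difference need not be integrable by itself. The Gaussian factor makes it so
    and, being positive, can be cancelled at the end.\<close>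
  define w where "w x = (f x - inv_fourier g x) * complex_of_real (std_normal_density x)" for x
  have int: "integrable lborel (\<lambda>x. f x * gauss_wave \<xi> x)"
    "integrable lborel (\<lambda>x. inv_fourier g x * gauss_wave \<xi> x)" for \<xi>
  proof -
    show "integrable lborel (\<lambda>x. f x * gauss_wave \<xi> x)"
      by (intro integrable_mult_L2 f2 wave)
    show "integrable lborel (\<lambda>x. inv_fourier g x * gauss_wave \<xi> x)"
      unfolding mult.commute[of "inv_fourier g _"]
      by (rule integrable_mult_bounded[OF integrable_gauss_wave _ cmod_inv_fourier_le[OF g]]) measurable
  qed
  \<comment> \<open>The frequency \<open>- t / (2 * pi)\<close> makes the phase of the wave equal to
    \<open>cis (t * x)\<close>.\<close>
  have w_cis: "w x * cis (t * x)
      = f x * gauss_wave (- t / (2 * pi)) x - inv_fourier g x * gauss_wave (- t / (2 * pi)) x" for t x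
    by (simp add: w_def gauss_wave_def algebra_simps)
  have "AE x in lborel. w x = 0"
  proof (rule fourier_unique)
    show "integrable lborel w"
    proof -
      have "w = (\<lambda>x. f x * gauss_wave 0 x - inv_fourier g x * gauss_wave 0 x)"
        using w_cis[of _ 0] by (intro ext) simp
      then show ?thesis using Bochner_Integration.integrable_diff[OF int, of 0 0] by simp
    qed
    show "(LINT x|lborel. w x * cis (t * x)) = 0" for t
      unfolding w_cis by (subst Bochner_Integration.integral_diff[OF int]) (simp add: parseval inv)
  qed
  then show ?thesis
  proof eventually_elim
    case (elim x)
    have "std_normal_density x > 0" by (simp add: normal_density_pos)
    with elim show ?case by (auto simp: w_def)
  qed
qed

section \<open>Hoelder regularity from decay\<close>

lemma cmod_cis_diff_le: "cmod (cis x - cis y) \<le> \<bar>x - y\<bar>"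
proof -
  have "cis x - cis y = cis y * (cis (x - y) - 1)"
    by (simp add: right_diff_distrib cis_mult)
  then have "cmod (cis x - cis y) = cmod (cis (x - y) - 1)"
    by (simp add: norm_mult)
  then show ?thesis using iexp_approx1[of "x - y" 0] by (simp add: cis_conv_exp)
qed

text \<open>Combines the bound by arc length, for distances up to 1, with the diameter 2 of the unit
  circle beyond.\<close>

lemma cmod_cis_diff_le_powr:
  assumes "0 < \<theta>" "\<theta> \<le> 1"
  shows "cmod (cis x - cis y) \<le> 2 * \<bar>x - y\<bar> powr \<theta>"
proof (cases "\<bar>x - y\<bar> \<le> 1")
  case True
  have "\<bar>x - y\<bar> powr 1 \<le> \<bar>x - y\<bar> powr \<theta>"
    using True assms by (intro powr_mono') auto
  moreover have "\<bar>x - y\<bar> powr \<theta> \<ge> 0" by simp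
  ultimately show ?thesis
    using cmod_cis_diff_le[of x y] by simp
next
  case False
  have "cmod (cis x - cis y) \<le> 2"
    using norm_triangle_ineq4[of "cis x" "cis y"] by simp
  moreover have "1 \<le> \<bar>x - y\<bar> powr \<theta>"
    using False assms by (intro ge_one_powr_ge_zero) auto
  ultimately show ?thesis by simp
qed

lemma integrable_powr_weight:
  assumes "\<delta> > 0"
  shows "integrable lborel (\<lambda>x::real. (1 + \<bar>x\<bar>) powr (- 1 - \<delta>))"
proof -
  define h where "h x = indicator {0..} x * (1 + \<bar>x\<bar>) powr (- 1 - \<delta>)" for x :: real
  have [measurable]: "h \<in> borel_measurable borel" unfolding h_def[abs_def] by measurable
  have h: "integrable lborel h"
  proof (rule integrableI_bounded)
    let ?F = "\<lambda>x::real. - ((1 + x) powr (- \<delta>) / \<delta>)"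
    have "(\<integral>\<^sup>+ x. ennreal ((1 + \<bar>x\<bar>) powr (- 1 - \<delta>)) * indicator {0..} x \<partial>lborel) = ennreal (0 - ?F 0)"
    proof (rule nn_integral_FTC_atLeast)
      show "(?F has_real_derivative (1 + \<bar>x\<bar>) powr (- 1 - \<delta>)) (at x)" if "0 \<le> x" for x
      proof -
        have eq: "- 1 - \<delta> = - \<delta> - 1" by simp
        show ?thesis
          unfolding eq using that assms by (auto intro!: derivative_eq_intros simp: field_simps)
      qed
      have "((\<lambda>x::real. (1 + x) powr (- \<delta>)) \<longlongrightarrow> 0) at_top"
        using assms by (intro tendsto_neg_powr filterlim_tendsto_add_at_top[OF tendsto_const] filterlim_ident) auto
      then have "(?F \<longlongrightarrow> - (0 / \<delta>)) at_top"
        using assms by (intro tendsto_intros) auto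
      then show "(?F \<longlongrightarrow> 0) at_top" by simp
    qed auto
    moreover have "(\<integral>\<^sup>+ x. ennreal (norm (h x)) \<partial>lborel)
        = (\<integral>\<^sup>+ x. ennreal ((1 + \<bar>x\<bar>) powr (- 1 - \<delta>)) * indicator {0..} x \<partial>lborel)"
      by (intro nn_integral_cong) (auto simp: h_def split: split_indicator)
    ultimately show "(\<integral>\<^sup>+ x. ennreal (norm (h x)) \<partial>lborel) < \<infinity>" by simp
  qed measurable
  have "integrable lborel (\<lambda>x. h (0 + - 1 * x))"
    by (rule lborel_integrable_real_affine[OF h]) simp
  \<comment> \<open>The sum with the reflection dominates the weight; the double value at 0 only
    enlarges the majorant.\<close>
  then have "integrable lborel (\<lambda>x. h x + h (- x))"
    using h by (intro Bochner_Integration.integrable_add) auto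
  then show ?thesis
    by (rule Bochner_Integration.integrable_bound) (auto simp: h_def split: split_indicator)
qed

lemma integrable_powr_decay:
  fixes w :: "real \<Rightarrow> 'a :: {banach, second_countable_topology}"
  assumes "w \<in> borel_measurable lborel" "\<delta> > 0"
    and bound: "\<And>x. norm (w x) \<le> C * (1 + \<bar>x\<bar>) powr (- 1 - \<delta>)"
  shows "integrable lborel w"
proof (rule Bochner_Integration.integrable_bound)
  show "integrable lborel (\<lambda>x::real. C * (1 + \<bar>x\<bar>) powr (- 1 - \<delta>))"
    by (intro integrable_mult_right integrable_powr_weight assms)
  have "norm (w x) \<le> norm (C * (1 + \<bar>x\<bar>) powr (- 1 - \<delta>))" for x
    using bound[of x] by (simp only: real_norm_def)
  then show "AE x in lborel. norm (w x) \<le> norm (C * (1 + \<bar>x\<bar>) powr (- 1 - \<delta>))" by simp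
qed fact

section \<open>Smoothness of the inverse Fourier integral\<close>

lemma continuous_inv_fourier:
  assumes g: "integrable lborel g"
  shows "continuous_on UNIV (inv_fourier g)"
proof (rule continuous_on_sequentiallyI)
  fix X :: "nat \<Rightarrow> real" and x assume X: "X \<longlonglongrightarrow> x"
  note [measurable] = borel_measurable_integrable[OF g]
  show "(\<lambda>n. inv_fourier g (X n)) \<longlonglongrightarrow> inv_fourier g x"
    unfolding inv_fourier_def
  proof (rule integral_dominated_convergence[where w = "\<lambda>\<gamma>. cmod (g \<gamma>)"])
    show "AE \<gamma> in lborel. (\<lambda>n. g \<gamma> * cis (2 * pi * X n * \<gamma>)) \<longlonglongrightarrow> g \<gamma> * cis (2 * pi * x * \<gamma>)"
      by (intro AE_I2 tendsto_intros X)
  qed (use g in \<open>auto simp: norm_mult\<close>)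
qed

text \<open>Differentiation under the integral sign. The error of the difference quotient is itself
  an integral, and along every sequence tending to \<open>x\<close> dominated convergence applies,
  with a multiple of \<open>norm (\<gamma> * g \<gamma>)\<close> as majorant.\<close>

lemma inv_fourier_has_vector_derivative:
  assumes g: "integrable lborel g"
    and g': "integrable lborel (\<lambda>\<gamma>. 2 * pi * \<i> * \<gamma> * g \<gamma>)"
  shows "(inv_fourier g has_vector_derivative inv_fourier (\<lambda>\<gamma>. 2 * pi * \<i> * \<gamma> * g \<gamma>) x) (at x)"
  unfolding has_vector_derivative_def has_derivative_iff_norm
proof (intro conjI bounded_linear_scaleR_left)
  note [measurable] = borel_measurable_integrable[OF g]
  let ?D = "inv_fourier (\<lambda>\<gamma>. 2 * pi * \<i> * \<gamma> * g \<gamma>) x"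
  define e where "e y \<gamma> = cis (2 * pi * y * \<gamma>)" for y \<gamma>
  \<comment> \<open>First-order Taylor remainder of the character, as a function of
    \<open>y\<close>.\<close>
  define R where "R y \<gamma> = e y \<gamma> - e x \<gamma> - ((y - x) * (2 * pi * \<gamma>)) *\<^sub>R (\<i> * e x \<gamma>)" for y \<gamma>
  have [measurable]: "(\<lambda>\<gamma>. e y \<gamma>) \<in> borel_measurable borel" for y unfolding e_def by measurable
  have [measurable]: "(\<lambda>\<gamma>. R y \<gamma>) \<in> borel_measurable borel" for y unfolding R_def by measurable
  have R_lim: "((\<lambda>y. norm (R y \<gamma>) / norm (y - x)) \<longlongrightarrow> 0) (at x)" for \<gamma>
  proof -
    have "((\<lambda>y. e y \<gamma>) has_derivative (\<lambda>t. (t * (2 * pi * \<gamma>)) *\<^sub>R (\<i> * e x \<gamma>))) (at x)"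
      unfolding e_def by (auto intro!: derivative_eq_intros simp: mult_ac)
    then show ?thesis
      unfolding has_derivative_iff_norm R_def by simp
  qed
  \<comment> \<open>Increment and linear term are each at most
    \<open>\<bar>(y - x) * (2 * pi * \<gamma>)\<bar>\<close>, hence the factor 2.\<close>
  have R_bound: "norm (R y \<gamma>) \<le> 2 * norm (y - x) * norm (2 * pi * \<gamma>)" for y \<gamma>
  proof -
    have "norm (R y \<gamma>) \<le> norm (e y \<gamma> - e x \<gamma>) + norm (((y - x) * (2 * pi * \<gamma>)) *\<^sub>R (\<i> * e x \<gamma>))"
      unfolding R_def by (rule norm_triangle_ineq4)
    moreover have "norm (e y \<gamma> - e x \<gamma>) \<le> \<bar>2 * pi * y * \<gamma> - 2 * pi * x * \<gamma>\<bar>"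
      unfolding e_def by (rule cmod_cis_diff_le)
    moreover have "2 * pi * y * \<gamma> - 2 * pi * x * \<gamma> = (y - x) * (2 * pi * \<gamma>)"
      by (simp add: algebra_simps)
    moreover have "norm (((y - x) * (2 * pi * \<gamma>)) *\<^sub>R (\<i> * e x \<gamma>)) = \<bar>(y - x) * (2 * pi * \<gamma>)\<bar>"
      by (simp add: e_def norm_mult abs_mult)
    ultimately show ?thesis unfolding real_norm_def by (simp only: abs_mult)
  qed
  have int_e: "integrable lborel (\<lambda>\<gamma>. f \<gamma> * e y \<gamma>)" if "integrable lborel f" for f y
    unfolding e_def using that by (intro integrable_mult_bounded[where C = 1]) auto
  have rem: "inv_fourier g y - inv_fourier g x - (y - x) *\<^sub>R ?D = (LINT \<gamma>|lborel. g \<gamma> * R y \<gamma>)" for y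
  proof -
    have "(LINT \<gamma>|lborel. g \<gamma> * R y \<gamma>) = (LINT \<gamma>|lborel. (g \<gamma> * e y \<gamma> - g \<gamma> * e x \<gamma>)
        - (y - x) *\<^sub>R (2 * pi * \<i> * \<gamma> * g \<gamma> * e x \<gamma>))"
      by (intro Bochner_Integration.integral_cong refl)
         (simp add: R_def scaleR_conv_of_real algebra_simps)
    also have "\<dots> = (LINT \<gamma>|lborel. g \<gamma> * e y \<gamma> - g \<gamma> * e x \<gamma>)
        - (LINT \<gamma>|lborel. (y - x) *\<^sub>R (2 * pi * \<i> * \<gamma> * g \<gamma> * e x \<gamma>))"
      by (intro Bochner_Integration.integral_diff Bochner_Integration.integrable_diff
          integrable_scaleR_right int_e g g')
    also have "(LINT \<gamma>|lborel. g \<gamma> * e y \<gamma> - g \<gamma> * e x \<gamma>) = inv_fourier g y - inv_fourier g x"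
      unfolding inv_fourier_def e_def[symmetric]
      by (intro Bochner_Integration.integral_diff int_e g)
    also have "(LINT \<gamma>|lborel. (y - x) *\<^sub>R (2 * pi * \<i> * \<gamma> * g \<gamma> * e x \<gamma>)) = (y - x) *\<^sub>R ?D"
      unfolding inv_fourier_def e_def[symmetric] by (rule integral_scaleR_right)
    finally show ?thesis by simp
  qed
  show "((\<lambda>y. norm (inv_fourier g y - inv_fourier g x - (y - x) *\<^sub>R ?D) / norm (y - x)) \<longlongrightarrow> 0) (at x)"
    unfolding tendsto_at_iff_sequentially o_def
  proof (intro allI impI)
    fix X :: "nat \<Rightarrow> real" assume X: "\<forall>i. X i \<in> UNIV - {x}" "X \<longlonglongrightarrow> x"
    have "(\<lambda>n. LINT \<gamma>|lborel. norm (g \<gamma>) * (norm (R (X n) \<gamma>) / norm (X n - x)))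
        \<longlonglongrightarrow> integral\<^sup>L lborel (\<lambda>\<gamma>::real. 0::real)"
    proof (rule integral_dominated_convergence[where w = "\<lambda>\<gamma>. 2 * norm (2 * pi * \<i> * \<gamma> * g \<gamma>)"])
      show "integrable lborel (\<lambda>\<gamma>. 2 * norm (2 * pi * \<i> * \<gamma> * g \<gamma>))"
        using g' by (intro integrable_mult_right integrable_norm)
      have "(\<lambda>n. norm (g \<gamma>) * (norm (R (X n) \<gamma>) / norm (X n - x))) \<longlonglongrightarrow> norm (g \<gamma>) * 0" for \<gamma>
        using R_lim[of \<gamma>] X unfolding tendsto_at_iff_sequentially o_def by (intro tendsto_intros) blast
      then show "AE \<gamma> in lborel. (\<lambda>n. norm (g \<gamma>) * (norm (R (X n) \<gamma>) / norm (X n - x))) \<longlonglongrightarrow> 0"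
        by simp
      fix n
      have "norm (norm (g \<gamma>) * (norm (R (X n) \<gamma>) / norm (X n - x))) \<le> 2 * norm (2 * pi * \<i> * \<gamma> * g \<gamma>)" for \<gamma>
      proof -
        have "norm (R (X n) \<gamma>) / norm (X n - x) \<le> 2 * norm (2 * pi * \<gamma>)"
          using R_bound[of "X n" \<gamma>] X(1) by (subst pos_divide_le_eq) (auto simp: mult_ac)
        then have "norm (g \<gamma>) * (norm (R (X n) \<gamma>) / norm (X n - x)) \<le> norm (g \<gamma>) * (2 * norm (2 * pi * \<gamma>))"
          by (intro mult_left_mono) auto
        then show ?thesis by (simp add: norm_mult abs_mult mult_ac)
      qed
      then show "AE \<gamma> in lborel. norm (norm (g \<gamma>) * (norm (R (X n) \<gamma>) / norm (X n - x)))
          \<le> 2 * norm (2 * pi * \<i> * \<gamma> * g \<gamma>)" by simp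
    qed measurable
    then have lim: "(\<lambda>n. LINT \<gamma>|lborel. norm (g \<gamma>) * (norm (R (X n) \<gamma>) / norm (X n - x))) \<longlonglongrightarrow> 0"
      by simp
    have "norm (inv_fourier g (X n) - inv_fourier g x - (X n - x) *\<^sub>R ?D) / norm (X n - x)
        \<le> (LINT \<gamma>|lborel. norm (g \<gamma>) * (norm (R (X n) \<gamma>) / norm (X n - x)))" for n
    proof -
      have "norm (LINT \<gamma>|lborel. g \<gamma> * R (X n) \<gamma>) \<le> (LINT \<gamma>|lborel. norm (g \<gamma> * R (X n) \<gamma>))"
        by (rule integral_norm_bound)
      then show ?thesis unfolding rem by (simp add: norm_mult divide_right_mono)
    qed
    with lim show "(\<lambda>n. norm (inv_fourier g (X n) - inv_fourier g x - (X n - x) *\<^sub>R ?D) / norm (X n - x)) \<longlonglongrightarrow> 0"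
      by (intro tendsto_sandwich[OF _ _ tendsto_const lim]) auto
  qed
qed

lemma inv_fourier_Hoelder:
  assumes \<theta>: "0 < \<theta>" "\<theta> \<le> 1" and g: "integrable lborel g"
    and g': "integrable lborel (\<lambda>\<gamma>. \<bar>\<gamma>\<bar> powr \<theta> * cmod (g \<gamma>))"
  shows "\<exists>C. \<forall>x y. cmod (inv_fourier g x - inv_fourier g y) \<le> C * \<bar>x - y\<bar> powr \<theta>"
proof (intro exI allI)
  fix x y
  let ?e = "\<lambda>x \<gamma>. cis (2 * pi * x * \<gamma>)"
  let ?I = "LINT \<gamma>|lborel. \<bar>\<gamma>\<bar> powr \<theta> * cmod (g \<gamma>)"
  have int: "integrable lborel (\<lambda>\<gamma>. g \<gamma> * ?e x \<gamma>)" for x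
    using g by (intro integrable_mult_bounded[where C = 1]) auto
  have diff: "inv_fourier g x - inv_fourier g y = (LINT \<gamma>|lborel. g \<gamma> * ?e x \<gamma> - g \<gamma> * ?e y \<gamma>)"
    unfolding inv_fourier_def by (intro Bochner_Integration.integral_diff[symmetric] int)
  have "cmod (inv_fourier g x - inv_fourier g y)
      \<le> (LINT \<gamma>|lborel. (2 * (2 * pi) powr \<theta> * \<bar>x - y\<bar> powr \<theta>) * (\<bar>\<gamma>\<bar> powr \<theta> * cmod (g \<gamma>)))"
    unfolding diff
  proof (rule Bochner_Integration.integral_norm_bound_integral)
    fix \<gamma>
    have "norm (?e x \<gamma> - ?e y \<gamma>) \<le> 2 * \<bar>2 * pi * x * \<gamma> - 2 * pi * y * \<gamma>\<bar> powr \<theta>"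
      by (rule cmod_cis_diff_le_powr[OF \<theta>])
    also have "2 * pi * x * \<gamma> - 2 * pi * y * \<gamma> = (2 * pi) * (x - y) * \<gamma>"
      by (simp add: algebra_simps)
    also have "\<bar>(2 * pi) * (x - y) * \<gamma>\<bar> powr \<theta> = (2 * pi) powr \<theta> * \<bar>x - y\<bar> powr \<theta> * \<bar>\<gamma>\<bar> powr \<theta>"
      by (simp add: abs_mult powr_mult)
    finally have "cmod (g \<gamma>) * norm (?e x \<gamma> - ?e y \<gamma>)
        \<le> cmod (g \<gamma>) * (2 * ((2 * pi) powr \<theta> * \<bar>x - y\<bar> powr \<theta> * \<bar>\<gamma>\<bar> powr \<theta>))"
      by (intro mult_left_mono) auto
    then show "norm (g \<gamma> * ?e x \<gamma> - g \<gamma> * ?e y \<gamma>)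
        \<le> (2 * (2 * pi) powr \<theta> * \<bar>x - y\<bar> powr \<theta>) * (\<bar>\<gamma>\<bar> powr \<theta> * cmod (g \<gamma>))"
      by (simp only: right_diff_distrib[symmetric] norm_mult mult_ac)
  qed (intro Bochner_Integration.integrable_diff int integrable_mult_right g')+
  also have "\<dots> = (2 * (2 * pi) powr \<theta> * ?I) * \<bar>x - y\<bar> powr \<theta>"
    by (subst integral_mult_right_zero) (simp only: mult_ac)
  finally show "cmod (inv_fourier g x - inv_fourier g y) \<le> (2 * (2 * pi) powr \<theta> * ?I) * \<bar>x - y\<bar> powr \<theta>" .
qed

text \<open>\<open>G k\<close> is the transform of the \<open>k\<close>-th derivative. A derivative
  costs one power of \<open>\<bar>\<gamma>\<bar>\<close> and a Hoelder exponent
  \<open>\<theta>\<close> costs \<open>\<theta>\<close> more, so integrability persists while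
  \<open>k + \<theta> < s\<close>. For \<open>k = n\<close> and \<open>\<theta> = r - n\<close> this
  reads \<open>r < s\<close>.\<close>

lemma inv_fourier_in_holder_space:
  assumes [measurable]: "g \<in> borel_measurable lborel"
    and bound: "\<And>\<gamma>. cmod (g \<gamma>) \<le> c * (1 + \<bar>\<gamma>\<bar>) powr (- 1 - s)"
    and r: "0 \<le> r" "r < s"
  shows "inv_fourier g \<in> holder_space r"
proof -
  define n where "n = nat \<lfloor>r\<rfloor>"
  have n: "real n \<le> r" "r < real n + 1" using r by (auto simp: n_def)
  have c: "c \<ge> 0"
    using order_trans[OF norm_ge_zero bound[of 0]] by simp
  define G where "G k \<gamma> = (2 * pi * \<i> * \<gamma>) ^ k * g \<gamma>" for k and \<gamma> :: real
  have G_meas [measurable]: "G k \<in> borel_measurable lborel" for k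
    unfolding G_def[abs_def] by measurable
  have G_bound: "\<bar>\<gamma>\<bar> powr \<theta> * cmod (G k \<gamma>) \<le> ((2 * pi) ^ k * c) * (1 + \<bar>\<gamma>\<bar>) powr (- 1 - (s - real k - \<theta>))"
    if "0 \<le> \<theta>" for k \<theta> \<gamma>
  proof -
    have "\<bar>\<gamma>\<bar> powr \<theta> * (\<bar>\<gamma>\<bar> ^ k * cmod (g \<gamma>))
        \<le> (1 + \<bar>\<gamma>\<bar>) powr \<theta> * ((1 + \<bar>\<gamma>\<bar>) ^ k * (c * (1 + \<bar>\<gamma>\<bar>) powr (- 1 - s)))"
      using that c by (intro mult_mono powr_mono2 power_mono bound) auto
    also have "\<dots> = c * ((1 + \<bar>\<gamma>\<bar>) powr \<theta> * ((1 + \<bar>\<gamma>\<bar>) powr real k * (1 + \<bar>\<gamma>\<bar>) powr (- 1 - s)))"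
      by (simp add: powr_realpow mult_ac)
    also have "(1 + \<bar>\<gamma>\<bar>) powr \<theta> * ((1 + \<bar>\<gamma>\<bar>) powr real k * (1 + \<bar>\<gamma>\<bar>) powr (- 1 - s))
        = (1 + \<bar>\<gamma>\<bar>) powr (- 1 - (s - real k - \<theta>))"
      by (simp add: powr_add[symmetric] algebra_simps)
    finally have "(2 * pi) ^ k * (\<bar>\<gamma>\<bar> powr \<theta> * (\<bar>\<gamma>\<bar> ^ k * cmod (g \<gamma>)))
        \<le> (2 * pi) ^ k * (c * (1 + \<bar>\<gamma>\<bar>) powr (- 1 - (s - real k - \<theta>)))"
      by (intro mult_left_mono) auto
    moreover have "cmod (G k \<gamma>) = (2 * pi) ^ k * (\<bar>\<gamma>\<bar> ^ k * cmod (g \<gamma>))"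
      by (simp add: G_def norm_mult norm_power power_mult_distrib)
    ultimately show ?thesis by (simp only: mult_ac)
  qed
  have G_int: "integrable lborel (G k)" if "real k < s" for k
  proof (rule integrable_powr_decay[where \<delta> = "s - real k"])
    fix \<gamma>
    show "norm (G k \<gamma>) \<le> ((2 * pi) ^ k * c) * (1 + \<bar>\<gamma>\<bar>) powr (- 1 - (s - real k))"
    \<comment> \<open>Because \<open>0 powr 0 = 0\<close>, the case \<open>\<theta> = 0\<close> of
      \<open>G_bound\<close> says nothing at the origin.\<close>
    proof (cases "\<gamma> = 0")
      case False
      then show ?thesis using G_bound[of 0 \<gamma> k] by simp
    next
      case True
      then show ?thesis using bound[of 0] c by (cases k) (auto simp: G_def)
    qed
  qed (use that in auto)
  have G_Suc: "G (Suc k) = (\<lambda>\<gamma>. 2 * pi * \<i> * \<gamma> * G k \<gamma>)" for k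
    by (auto simp: G_def)
  let ?D = "\<lambda>k. inv_fourier (G k)"
  have "?D 0 = inv_fourier g" by (simp add: G_def[abs_def])
  moreover have "(?D i has_vector_derivative ?D (Suc i) x) (at x)" if "i < n" for i x
  proof -
    have "real i < s" "real (Suc i) < s" using that n r by linarith+
    from G_int[OF this(1)] G_int[OF this(2)] show ?thesis
      unfolding G_Suc by (rule inv_fourier_has_vector_derivative)
  qed
  moreover have Gn: "integrable lborel (G n)" using n r by (intro G_int) linarith
  then have "continuous_on UNIV (?D n)" by (rule continuous_inv_fourier)
  moreover have "\<exists>C. \<forall>x y. cmod (?D n x - ?D n y) \<le> C * \<bar>x - y\<bar> powr (r - real n)" if "real n < r"
  proof (rule inv_fourier_Hoelder[OF _ _ Gn])
    show "integrable lborel (\<lambda>\<gamma>. \<bar>\<gamma>\<bar> powr (r - real n) * cmod (G n \<gamma>))"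
    proof (rule integrable_powr_decay[where \<delta> = "s - r"])
      show "norm (\<bar>\<gamma>\<bar> powr (r - real n) * cmod (G n \<gamma>))
          \<le> ((2 * pi) ^ n * c) * (1 + \<bar>\<gamma>\<bar>) powr (- 1 - (s - r))" for \<gamma>
        using G_bound[of "r - real n" \<gamma> n] n by simp
    qed (use r in auto)
  qed (use that n in auto)
  ultimately show ?thesis
    unfolding holder_space_def Let_def n_def[symmetric] by (intro CollectI exI[of _ ?D]) blast
qed

section \<open>Decay and regularity of pseudo-splines\<close>

theorem theorem5p3:
  fixes \<alpha> :: real and l :: nat and \<phi> :: "real \<Rightarrow> complex"
  assumes "\<alpha> \<ge> 1"
    and "int l \<le> \<lfloor>\<alpha> - 1/2\<rfloor>"
    and "is_pseudo_spline \<alpha> l \<phi>"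
  shows "(\<exists>c>0. \<forall>\<gamma>. cmod (ps_hat \<alpha> l \<gamma>)
              \<le> c * (1 + \<bar>\<gamma>\<bar>) powr (- 2 * \<alpha> + ps_kappa \<alpha> l)) \<and>
         (let s = 2 * \<alpha> - ps_kappa \<alpha> l - 1 in
            \<forall>\<epsilon>>0. s - \<epsilon> \<ge> 0 \<longrightarrow>
              (\<exists>\<psi> \<in> holder_space (s - \<epsilon>). AE x in lborel. \<phi> x = \<psi> x))"
proof -
  define s where "s = 2 * \<alpha> - ps_kappa \<alpha> l - 1"
  have l: "real l \<le> \<alpha>" using assms(2) by linarith
  obtain c where c: "c > 0"
    "\<And>\<gamma>. cmod (ps_hat \<alpha> l \<gamma>) \<le> c * (1 + \<bar>\<gamma>\<bar>) powr (- 2 * \<alpha> + ps_kappa \<alpha> l)"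
    using ps_hat_decay[OF assms(1) l] by blast
  have bound: "cmod (ps_hat \<alpha> l \<gamma>) \<le> c * (1 + \<bar>\<gamma>\<bar>) powr (- 1 - s)" for \<gamma>
    using c(2)[of \<gamma>] by (simp add: s_def)
  have fourier: "has_L2_fourier \<phi> (ps_hat \<alpha> l)"
    using assms(3) by (simp add: is_pseudo_spline_def)
  \<comment> \<open>Measurability of the infinite product is part of its membership in L2.\<close>
  then have meas: "ps_hat \<alpha> l \<in> borel_measurable lborel"
    by (simp add: has_L2_fourier_def L2_def)
  have "\<exists>\<psi> \<in> holder_space (s - \<epsilon>). AE x in lborel. \<phi> x = \<psi> x" if "\<epsilon> > 0" "s - \<epsilon> \<ge> 0" for \<epsilon>
  proof (intro bexI)
    \<comment> \<open>Here \<open>s \<ge> \<epsilon> > 0\<close>, so the decay exponent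
      \<open>- 1 - s\<close> is below -1.\<close>
    have "integrable lborel (ps_hat \<alpha> l)"
      using that by (intro integrable_powr_decay[OF meas _ bound]) auto
    then show "AE x in lborel. \<phi> x = inv_fourier (ps_hat \<alpha> l) x"
      by (rule L2_fourier_inversion[OF fourier])
    show "inv_fourier (ps_hat \<alpha> l) \<in> holder_space (s - \<epsilon>)"
      using that by (intro inv_fourier_in_holder_space[OF meas bound]) auto
  qed
  with c show ?thesis unfolding s_def Let_def by blast
qed

end
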